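(* Let $(X,\mathcal B,m,T)$ be a probability preserving transformation, let $\mathcal C\subset\mathcal B$ be a factor, let $\mathcal K=\{n_k\}_{k\ge1}$ be a sequence of positive integers with $n_k\to\infty$, let $d_k>0$ $(k\ge1)$ and let $t\ge0$. (a) If there is a countable $T$-generator $P$ satisfying $$\frac{\log K_{\mathcal C}(P,n_k,\varepsilon)}{d_k}\longrightarrow Y\quad\text{in distribution as }k\to\infty,\ \varepsilon\to0,$$ where $Y$ is a random variable on $[0,\infty]$, then for every countable $T$-generator $Q$, $$\frac{\log K_{\mathcal C}(Q,n_k,\varepsilon)}{d_k}\longrightarrow Y\quad\text{in distribution as }k\to\infty,\ \varepsilon\to0.$$ (b) If $$\frac{\log K_{\mathcal C}(P,n_k,\varepsilon)}{n_k^t}\longrightarrow 0\quad\text{in measure as }k\to\infty,\ \varepsilon\to0$$ for some countable $T$-generator $P$, then $\overline{\mathrm{E\mbox{-}dim}}_{\mathcal K}(T,\mathcal C)\le t$. (c) If $$\frac{\log K_{\mathcal C}(P,n_k,\varepsilon)}{n_k^t}\longrightarrow \infty\quad\text{in measure as }k\to\infty,\ \varepsilon\to0$$ for some countable measurable partition $P$ of $X$, then $\underline{\mathrm{E\mbox{-}dim}}_{\mathcal K}(T,\mathcal C)\ge t$.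
   Context: A probability preserving transformation $(X,\mathcal B,m,T)$ is an invertible measure preserving transformation $T$ of a probability space $(X,\mathcal B,m)$; a factor is a $T$-invariant sub-$\sigma$-algebra $\mathcal C\subset\mathcal B$; $m(\cdot\|\mathcal C)$ denotes conditional measure with respect to $\mathcal C$. A (countable) $T$-generator is a countable measurable partition $P$ of $X$ with $\sigma\big(\bigcup_{n\in\mathbb Z}T^nP\big)=\mathcal B$ mod $m$. For a countable measurable partition $P$, $P(z)$ is the element of $P$ containing $z$. For $n\ge1$ define the pseudometric $d_n^{(P)}(x,y):=\frac1n\#\{0\le k\le n-1: P(T^kx)\ne P(T^ky)\}$ and the balls $B(n,P,x,\varepsilon):=\{y\in X: d_n^{(P)}(x,y)\le\varepsilon\}$ (each such ball is a union of elements of $\bigvee_{j=0}^{n-1}T^{-j}P$). For $\varepsilon>0$, the relative complexity is the $\mathcal C$-measurable random variable $$K_{\mathcal C}(P,n,\varepsilon)(x):=\min\Big\{\#F:\ F\subset X,\ m\Big(\bigcup_{z\in F}B(n,P,z,\varepsilon)\,\Big\|\,\mathcal C\Big)(x)>1-\varepsilon\Big\}.$$ Double limits, for random variables $Z_{k,\varepsilon}\ge0$ on $(X,\mathcal B,m)$: "$Z_{k,\varepsilon}\to Y$ in distribution as $k\to\infty,\ \varepsilon\to0$" means that for every continuous $g:[0,\infty]\to\mathbb R$, $\lim_{\varepsilon\to0}\limsup_{k\to\infty}|E(g(Z_{k,\varepsilon}))-E(g(Y))|=0$; "$Z_{k,\varepsilon}\to0$ in measure" means that for every $\eta>0$, $\lim_{\varepsilon\to0}\limsup_{k\to\infty}m(Z_{k,\varepsilon}>\eta)=0$;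 "$Z_{k,\varepsilon}\to\infty$ in measure" means that for every $M>0$, $\lim_{\varepsilon\to0}\limsup_{k\to\infty}m(Z_{k,\varepsilon}<M)=0$. Relative entropy dimensions along $\mathcal K=\{n_k\}$: $$\overline{\mathrm{E\mbox{-}dim}}_{\mathcal K}(T,\mathcal C):=\inf\Big\{s\ge0:\ \frac{\log K_{\mathcal C}(P,n_k,\varepsilon)}{n_k^s}\to0\text{ in measure as }k\to\infty,\varepsilon\to0,\ \text{for every countable measurable partition }P\Big\},$$ $$\underline{\mathrm{E\mbox{-}dim}}_{\mathcal K}(T,\mathcal C):=\sup\Big\{s\ge0:\ \text{there is a countable measurable partition }P\text{ with }\frac{\log K_{\mathcal C}(P,n_k,\varepsilon)}{n_k^s}\to\infty\text{ in measure as }k\to\infty,\varepsilon\to0\Big\}.$$ *)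

theory Defs
  imports "HOL-Probability.Probability"
begin

definition invertible_mpt :: "'a measure \<Rightarrow> ('a \<Rightarrow> 'a) \<Rightarrow> bool" where
  "invertible_mpt M T \<longleftrightarrow>
     T \<in> M \<rightarrow>\<^sub>M M \<and> bij_betw T (space M) (space M) \<and>
     inv_into (space M) T \<in> M \<rightarrow>\<^sub>M M \<and> distr M M T = M"

text \<open>Sub-sigma-algebras are represented, as in the library, by a measure \<open>C\<close> with
  \<^const>\<open>subalgebra\<close> \<open>M C\<close>; only its space and its measurable sets matter. For invertible \<open>T\<close>,
  invariance means \<open>T\<^sup>-\<^sup>1 C = C\<close> (equivalently \<open>T C = C\<close>), not merely an inclusion.\<close>

definition is_factor :: "'a measure \<Rightarrow> ('a \<Rightarrow> 'a) \<Rightarrow> 'a measure \<Rightarrow> bool" where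
  "is_factor M T C \<longleftrightarrow>
     subalgebra M C \<and> (\<lambda>A. T -` A \<inter> space M) ` sets C = sets C"

definition countable_partition :: "'a measure \<Rightarrow> 'a set set \<Rightarrow> bool" where
  "countable_partition M P \<longleftrightarrow> countable P \<and> P \<subseteq> sets M \<and> partition_on (space M) P"

definition int_iterate :: "'a measure \<Rightarrow> ('a \<Rightarrow> 'a) \<Rightarrow> int \<Rightarrow> 'a \<Rightarrow> 'a" where
  "int_iterate M T i =
     (if i \<ge> 0 then T ^^ nat i else inv_into (space M) T ^^ nat (- i))"

definition generator :: "'a measure \<Rightarrow> ('a \<Rightarrow> 'a) \<Rightarrow> 'a set set \<Rightarrow> bool" where
  "generator M T P \<longleftrightarrow>
     countable_partition M P \<and>
     (\<forall>A\<in>sets M. \<exists>A'\<in>sigma_sets (space M) (\<Union>i. (\<lambda>S. int_iterate M T i ` S) ` P).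
        emeasure M (sym_diff A A') = 0)"

definition cell :: "'a set set \<Rightarrow> 'a \<Rightarrow> 'a set" where
  "cell P z = (THE A. A \<in> P \<and> z \<in> A)"

definition hamming_dist :: "('a \<Rightarrow> 'a) \<Rightarrow> 'a set set \<Rightarrow> nat \<Rightarrow> 'a \<Rightarrow> 'a \<Rightarrow> real" where
  "hamming_dist T P n x y =
     real (card {k. k < n \<and> cell P ((T ^^ k) x) \<noteq> cell P ((T ^^ k) y)}) / real n"

definition hamming_ball ::
    "'a measure \<Rightarrow> ('a \<Rightarrow> 'a) \<Rightarrow> nat \<Rightarrow> 'a set set \<Rightarrow> 'a \<Rightarrow> real \<Rightarrow> 'a set" where
  "hamming_ball M T n P x \<epsilon> = {y \<in> space M. hamming_dist T P n x y \<le> \<epsilon>}"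

definition cond_measure :: "'a measure \<Rightarrow> 'a measure \<Rightarrow> 'a set \<Rightarrow> 'a \<Rightarrow> real" where
  "cond_measure M C A = real_cond_exp M C (indicator A)"

text \<open>For a fixed countable partition \<open>P\<close> and fixed \<open>n\<close>, \<open>\<epsilon>\<close>, only countably many sets
  \<open>\<Union>z\<in>F. hamming_ball M T n P z \<epsilon>\<close> with \<open>F\<close> finite occur, so the choice of versions of the
  conditional measures is immaterial up to a null set. Off a null set some finite \<open>F\<close> is
  admissible (\<open>\<epsilon> > 0\<close>), so restricting to finite \<open>F\<close> and minimising over \<open>nat\<close>
  loses nothing.\<close>

definition rel_complexity ::
    "'a measure \<Rightarrow> ('a \<Rightarrow> 'a) \<Rightarrow> 'a measure \<Rightarrow> 'a set set \<Rightarrow> nat \<Rightarrow> real \<Rightarrow> 'a \<Rightarrow> nat" where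
  "rel_complexity M T C P n \<epsilon> x =
     (LEAST j. \<exists>F. finite F \<and> F \<subseteq> space M \<and> card F = j \<and>
        cond_measure M C (\<Union>z\<in>F. hamming_ball M T n P z \<epsilon>) x > 1 - \<epsilon>)"

text \<open>Double limits \<open>k \<rightarrow> \<infinity>\<close>, \<open>\<epsilon> \<rightarrow> 0\<close> of nonnegative random variables \<open>Z k \<epsilon>\<close>. The compact
  interval \<open>[0,\<infinity>]\<close> is \<open>ennreal\<close>, and \<open>Y\<close> may live on another probability space.\<close>

definition tends_in_distr ::
    "'a measure \<Rightarrow> (nat \<Rightarrow> real \<Rightarrow> 'a \<Rightarrow> real) \<Rightarrow> 'b measure \<Rightarrow> ('b \<Rightarrow> ennreal) \<Rightarrow> bool" where
  "tends_in_distr M Z N Y \<longleftrightarrow>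
     (\<forall>g :: ennreal \<Rightarrow> real. continuous_on UNIV g \<longrightarrow>
        ((\<lambda>\<epsilon>. limsup (\<lambda>k. ereal \<bar>(\<integral>x. g (ennreal (Z k \<epsilon> x)) \<partial>M) - (\<integral>y. g (Y y) \<partial>N)\<bar>))
           \<longlongrightarrow> 0) (at_right 0))"

definition tends_zero_in_measure ::
    "'a measure \<Rightarrow> (nat \<Rightarrow> real \<Rightarrow> 'a \<Rightarrow> real) \<Rightarrow> bool" where
  "tends_zero_in_measure M Z \<longleftrightarrow>
     (\<forall>\<eta>>0. ((\<lambda>\<epsilon>. limsup (\<lambda>k. ereal (measure M {x \<in> space M. Z k \<epsilon> x > \<eta>})))
        \<longlongrightarrow> 0) (at_right 0))"

definition tends_infinity_in_measure ::
    "'a measure \<Rightarrow> (nat \<Rightarrow> real \<Rightarrow> 'a \<Rightarrow> real) \<Rightarrow> bool" where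
  "tends_infinity_in_measure M Z \<longleftrightarrow>
     (\<forall>R>0. ((\<lambda>\<epsilon>. limsup (\<lambda>k. ereal (measure M {x \<in> space M. Z k \<epsilon> x < R})))
        \<longlongrightarrow> 0) (at_right 0))"

definition log_complexity_ratio ::
    "'a measure \<Rightarrow> ('a \<Rightarrow> 'a) \<Rightarrow> 'a measure \<Rightarrow> 'a set set \<Rightarrow> (nat \<Rightarrow> nat) \<Rightarrow> (nat \<Rightarrow> real)
      \<Rightarrow> nat \<Rightarrow> real \<Rightarrow> 'a \<Rightarrow> real" where
  "log_complexity_ratio M T C P n d k \<epsilon> x = ln (real (rel_complexity M T C P (n k) \<epsilon> x)) / d k"

text \<open>Infimum and supremum are taken in \<open>[0,\<infinity>]\<close>, so that \<open>sup {} = 0\<close> and \<open>inf {} = \<infinity>\<close>.\<close>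

definition upper_E_dim ::
    "'a measure \<Rightarrow> ('a \<Rightarrow> 'a) \<Rightarrow> 'a measure \<Rightarrow> (nat \<Rightarrow> nat) \<Rightarrow> ennreal" where
  "upper_E_dim M T C n =
     Inf {ennreal s | s. s \<ge> 0 \<and>
       (\<forall>P. countable_partition M P \<longrightarrow>
          tends_zero_in_measure M
            (log_complexity_ratio M T C P n (\<lambda>k. real (n k) powr s)))}"

definition lower_E_dim ::
    "'a measure \<Rightarrow> ('a \<Rightarrow> 'a) \<Rightarrow> 'a measure \<Rightarrow> (nat \<Rightarrow> nat) \<Rightarrow> ennreal" where
  "lower_E_dim M T C n =
     Sup {ennreal s | s. s \<ge> 0 \<and>
       (\<exists>P. countable_partition M P \<and>
          tends_infinity_in_measure M
            (log_complexity_ratio M T C P n (\<lambda>k. real (n k) powr s)))}"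

end

theory Submission
  imports Defs
begin

text \<open>Part (c) is the definition of a supremum. Parts (a) and (b) rest on one comparison
  (\<open>rel_complexity_generator_dominates\<close>): if \<open>P\<close> generates and \<open>Q\<close> is any countable partition,
  then for every \<open>\<epsilon> > 0\<close>, for all sufficiently small \<open>\<delta> > 0\<close> and all large \<open>n\<close>, the relative
  complexity of \<open>Q\<close> at scale \<open>\<epsilon>\<close> is at most that of \<open>P\<close> at scale \<open>\<delta>\<close>, off a set of small measure.
  The inequality has no multiplicative loss, and so it survives division by an arbitrary
  normalisation \<open>d\<close>.

  For the comparison, generation gives a set \<open>B\<close> of small measure and a window length \<open>N\<close> such that
  outside \<open>B\<close> the \<open>P\<close>-names over the times \<open>-N, ..., N\<close> decide the cell of \<open>Q\<close>
  (\<open>generator_coding\<close>). By Markov's inequality most points visit \<open>B\<close> rarely up to time \<open>n\<close>; let \<open>G\<close> be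
  the set of those. On \<open>G\<close> the normalised Hamming distance for \<open>Q\<close> is at most \<open>2 N + 1\<close> times the one
  for \<open>P\<close>, up to a small error (\<open>hamming_dist_recode\<close>). A \<open>P\<close>-ball that meets \<open>G\<close> can be recentred at
  a point of \<open>G\<close>, and after this its part inside \<open>G\<close> lies in one \<open>Q\<close>-ball
  (\<open>recentred_ball_union\<close>). Thus a family of \<open>P\<close>-balls covering almost everything, conditionally
  on \<open>C\<close>, yields a \<open>Q\<close>-family with no more members, wherever the conditional measure of \<open>G\<close> is
  close to 1; Markov's inequality, now for the conditional measure of the complement of \<open>G\<close>, shows
  that this is so off a set of small measure.

  Part (b) follows at once, since \<open>Q\<close> is arbitrary. In part (a) the comparison holds in both
  directions. It controls \<open>E(H(Z))\<close> for monotone \<open>H\<close> only, but the powers of the decreasing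
  coordinate \<open>1 / (1 + z)\<close> on \<open>[0,\<infinity>]\<close> are monotone and, by the Weierstrass approximation theorem,
  span a dense space of continuous functions (\<open>tends_in_distr_dominated\<close>).\<close>

section \<open>Double limits\<close>

lemma tendsto_limsup_zero_iff:
  fixes f :: "nat \<Rightarrow> real \<Rightarrow> real"
  assumes nonneg: "\<And>k \<epsilon>. f k \<epsilon> \<ge> 0"
  shows "((\<lambda>\<epsilon>. limsup (\<lambda>k. ereal (f k \<epsilon>))) \<longlongrightarrow> 0) (at_right 0)
    \<longleftrightarrow> (\<forall>\<tau>>0. \<forall>\<^sub>F \<epsilon> in at_right 0. \<forall>\<^sub>F k in sequentially. f k \<epsilon> < \<tau>)"
proof (intro iffI allI impI)
  fix \<tau> :: real
  assume lim: "((\<lambda>\<epsilon>. limsup (\<lambda>k. ereal (f k \<epsilon>))) \<longlongrightarrow> 0) (at_right 0)" and "\<tau> > 0"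
  then have "\<forall>\<^sub>F \<epsilon> in at_right 0. limsup (\<lambda>k. ereal (f k \<epsilon>)) < ereal \<tau>"
    by (intro order_tendstoD(2)) auto
  then show "\<forall>\<^sub>F \<epsilon> in at_right 0. \<forall>\<^sub>F k in sequentially. f k \<epsilon> < \<tau>"
    by eventually_elim (use Limsup_lessD in force)
next
  assume R: "\<forall>\<tau>>0. \<forall>\<^sub>F \<epsilon> in at_right 0. \<forall>\<^sub>F k in sequentially. f k \<epsilon> < \<tau>"
  show "((\<lambda>\<epsilon>. limsup (\<lambda>k. ereal (f k \<epsilon>))) \<longlongrightarrow> 0) (at_right 0)"
  proof (rule order_tendstoI)
    fix a :: ereal assume "a < 0"
    moreover have "0 \<le> limsup (\<lambda>k. ereal (f k \<epsilon>))" for \<epsilon>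
      by (intro le_Limsup) (auto simp: nonneg)
    ultimately have "a < limsup (\<lambda>k. ereal (f k \<epsilon>))" for \<epsilon> using less_le_trans by blast
    then show "\<forall>\<^sub>F \<epsilon> in at_right 0. a < limsup (\<lambda>k. ereal (f k \<epsilon>))" by simp
  next
    fix a :: ereal assume "0 < a"
    then obtain \<tau> where \<tau>: "0 < ereal \<tau>" "ereal \<tau> < a"
      using ereal_dense2 by blast
    then have "\<forall>\<^sub>F \<epsilon> in at_right 0. \<forall>\<^sub>F k in sequentially. f k \<epsilon> < \<tau>" using R by simp
    then show "\<forall>\<^sub>F \<epsilon> in at_right 0. limsup (\<lambda>k. ereal (f k \<epsilon>)) < a"
    proof eventually_elim
      case (elim \<epsilon>)
      then have "limsup (\<lambda>k. ereal (f k \<epsilon>)) \<le> ereal \<tau>"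
        by (intro Limsup_bounded) (auto elim: eventually_mono)
      then show ?case using \<tau>(2) by (rule le_less_trans)
    qed
  qed
qed

text \<open>The quantifiers place \<open>\<delta>\<close> after \<open>\<epsilon>\<close>: the complexities grow as the scale shrinks, so \<open>W\<close> at a
  scale fine enough bounds \<open>Z\<close> at the given scale. All sufficiently small \<open>\<delta>\<close> are demanded, so that
  this can be combined with other statements that hold eventually as \<open>\<delta> \<rightarrow> 0\<close>.\<close>

definition asymptotically_dominated ::
    "'a measure \<Rightarrow> (nat \<Rightarrow> real \<Rightarrow> 'a \<Rightarrow> real) \<Rightarrow> (nat \<Rightarrow> real \<Rightarrow> 'a \<Rightarrow> real) \<Rightarrow> bool" where
  "asymptotically_dominated M Z W \<longleftrightarrow>
     (\<forall>\<epsilon>>0. \<forall>\<rho>>0. \<forall>\<^sub>F \<delta> in at_right 0. \<forall>\<^sub>F k in sequentially.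
        measure M {x \<in> space M. W k \<delta> x < Z k \<epsilon> x} \<le> \<rho>)"

lemma tends_zero_in_measure_dominated:
  assumes "prob_space M"
    and Z [measurable]: "\<And>k \<epsilon>. Z k \<epsilon> \<in> borel_measurable M"
    and W [measurable]: "\<And>k \<epsilon>. W k \<epsilon> \<in> borel_measurable M"
    and dom: "asymptotically_dominated M Z W" and zero: "tends_zero_in_measure M W"
  shows "tends_zero_in_measure M Z"
  unfolding tends_zero_in_measure_def tendsto_limsup_zero_iff[OF measure_nonneg]
proof (intro allI impI)
  interpret prob_space M by fact
  fix \<eta> \<tau> :: real assume "\<eta> > 0" "\<tau> > 0"
  have "\<forall>\<^sub>F k in sequentially. measure M {x \<in> space M. Z k \<epsilon> x > \<eta>} < \<tau>" if "\<epsilon> > 0" for \<epsilon>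
  proof -
    have "\<forall>\<^sub>F \<delta> in at_right 0. \<forall>\<^sub>F k in sequentially. measure M {x \<in> space M. W k \<delta> x < Z k \<epsilon> x} \<le> \<tau> / 2"
      using dom \<open>\<epsilon> > 0\<close> half_gt_zero[OF \<open>\<tau> > 0\<close>] unfolding asymptotically_dominated_def by blast
    moreover have "\<forall>\<^sub>F \<delta> in at_right 0. \<forall>\<^sub>F k in sequentially. measure M {x \<in> space M. W k \<delta> x > \<eta>} < \<tau> / 2"
      using zero \<open>\<eta> > 0\<close> half_gt_zero[OF \<open>\<tau> > 0\<close>]
      unfolding tends_zero_in_measure_def tendsto_limsup_zero_iff[OF measure_nonneg] by blast
    ultimately obtain \<delta> where
      "\<forall>\<^sub>F k in sequentially. measure M {x \<in> space M. W k \<delta> x < Z k \<epsilon> x} \<le> \<tau> / 2"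
      "\<forall>\<^sub>F k in sequentially. measure M {x \<in> space M. W k \<delta> x > \<eta>} < \<tau> / 2"
      using eventually_happens'[OF trivial_limit_at_right_real eventually_conj] by blast
    then show ?thesis
    proof eventually_elim
      case (elim k)
      have "measure M {x \<in> space M. Z k \<epsilon> x > \<eta>}
          \<le> measure M ({x \<in> space M. W k \<delta> x < Z k \<epsilon> x} \<union> {x \<in> space M. W k \<delta> x > \<eta>})"
        by (intro finite_measure_mono) auto
      also have "\<dots> \<le> measure M {x \<in> space M. W k \<delta> x < Z k \<epsilon> x} + measure M {x \<in> space M. W k \<delta> x > \<eta>}"
        by (intro measure_Un_le) auto
      finally show ?case using elim by simp
    qed
  qed
  then show "\<forall>\<^sub>F \<epsilon> in at_right 0. \<forall>\<^sub>F k in sequentially. measure M {x \<in> space M. Z k \<epsilon> x > \<eta>} < \<tau>"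
    by (intro eventually_mono[OF eventually_at_right_less])
qed

text \<open>The values of \<open>H\<close> lie in \<open>[0,1]\<close>, so the set where the pointwise comparison fails costs at most its
  measure.\<close>

lemma integral_antimono_le:
  fixes H :: "ennreal \<Rightarrow> real"
  assumes "prob_space M"
    and H: "antimono H" "\<And>z. 0 \<le> H z" "\<And>z. H z \<le> 1" and [measurable]: "H \<in> borel_measurable borel"
    and [measurable]: "U \<in> borel_measurable M" "V \<in> borel_measurable M"
  shows "(\<integral>x. H (ennreal (V x)) \<partial>M) \<le> (\<integral>x. H (ennreal (U x)) \<partial>M) + measure M {x \<in> space M. V x < U x}"
proof -
  interpret prob_space M by fact
  let ?S = "{x \<in> space M. V x < U x}"
  have int: "integrable M (\<lambda>x. H (ennreal (F x)))" if [measurable]: "F \<in> borel_measurable M" for F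
    using H(2,3) by (intro integrable_const_bound[where B = 1]) auto
  have "H (ennreal (V x)) \<le> H (ennreal (U x)) + indicator ?S x" if "x \<in> space M" for x
  proof (cases "V x < U x")
    case True
    then show ?thesis using H(3)[of "ennreal (V x)"] H(2)[of "ennreal (U x)"] that by simp
  next
    case False
    then have "H (ennreal (V x)) \<le> H (ennreal (U x))"
      by (intro antimonoD[OF H(1)] ennreal_leI) simp
    then show ?thesis by (simp add: add_increasing2)
  qed
  then have "(\<integral>x. H (ennreal (V x)) \<partial>M) \<le> (\<integral>x. H (ennreal (U x)) + indicator ?S x \<partial>M)"
    using int by (intro integral_mono Bochner_Integration.integrable_add)
      (auto simp: integrable_indicator_iff emeasure_eq_measure)
  also have "\<dots> = (\<integral>x. H (ennreal (U x)) \<partial>M) + measure M ?S"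
    using int by (subst Bochner_Integration.integral_add)
      (auto simp: integrable_indicator_iff emeasure_eq_measure)
  finally show ?thesis .
qed

definition double_limit :: "(nat \<Rightarrow> real \<Rightarrow> real) \<Rightarrow> real \<Rightarrow> bool" where
  "double_limit a l \<longleftrightarrow> (\<forall>\<tau>>0. \<forall>\<^sub>F \<epsilon> in at_right 0. \<forall>\<^sub>F k in sequentially. \<bar>a k \<epsilon> - l\<bar> < \<tau>)"

lemma tends_in_distr_iff:
  "tends_in_distr M Z N Y \<longleftrightarrow> (\<forall>g :: ennreal \<Rightarrow> real. continuous_on UNIV g \<longrightarrow>
     double_limit (\<lambda>k \<epsilon>. \<integral>x. g (ennreal (Z k \<epsilon> x)) \<partial>M) (\<integral>y. g (Y y) \<partial>N))"
  unfolding tends_in_distr_def double_limit_def by (subst tendsto_limsup_zero_iff) auto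

lemma double_limit_add:
  assumes "double_limit a l" "double_limit b m"
  shows "double_limit (\<lambda>k \<epsilon>. a k \<epsilon> + b k \<epsilon>) (l + m)"
  unfolding double_limit_def
proof (intro allI impI)
  fix \<tau> :: real assume "\<tau> > 0"
  then have "\<tau> / 2 > 0" by simp
  have "\<forall>\<^sub>F \<epsilon> in at_right 0. \<forall>\<^sub>F k in sequentially. \<bar>a k \<epsilon> - l\<bar> < \<tau> / 2"
    and "\<forall>\<^sub>F \<epsilon> in at_right 0. \<forall>\<^sub>F k in sequentially. \<bar>b k \<epsilon> - m\<bar> < \<tau> / 2"
    using assms \<open>\<tau> / 2 > 0\<close> unfolding double_limit_def by blast+
  then show "\<forall>\<^sub>F \<epsilon> in at_right 0. \<forall>\<^sub>F k in sequentially. \<bar>a k \<epsilon> + b k \<epsilon> - (l + m)\<bar> < \<tau>"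
  proof eventually_elim
    case (elim \<epsilon>)
    then show ?case by eventually_elim linarith
  qed
qed

lemma double_limit_cmult:
  assumes "double_limit a l"
  shows "double_limit (\<lambda>k \<epsilon>. c * a k \<epsilon>) (c * l)"
proof (cases "c = 0")
  case False
  show ?thesis unfolding double_limit_def
  proof (intro allI impI)
    fix \<tau> :: real assume "\<tau> > 0"
    then have "\<tau> / \<bar>c\<bar> > 0" using False by simp
    then have "\<forall>\<^sub>F \<epsilon> in at_right 0. \<forall>\<^sub>F k in sequentially. \<bar>a k \<epsilon> - l\<bar> < \<tau> / \<bar>c\<bar>"
      using assms unfolding double_limit_def by blast
    moreover have "\<bar>c * a k \<epsilon> - c * l\<bar> = \<bar>c\<bar> * \<bar>a k \<epsilon> - l\<bar>" for k \<epsilon>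
      by (simp add: abs_mult[symmetric] right_diff_distrib)
    ultimately show "\<forall>\<^sub>F \<epsilon> in at_right 0. \<forall>\<^sub>F k in sequentially. \<bar>c * a k \<epsilon> - c * l\<bar> < \<tau>"
      using False by (simp add: field_simps)
  qed
qed (simp add: double_limit_def)

lemma double_limit_sum:
  "(\<And>i. i \<in> I \<Longrightarrow> double_limit (a i) (l i)) \<Longrightarrow> double_limit (\<lambda>k \<epsilon>. \<Sum>i\<in>I. a i k \<epsilon>) (\<Sum>i\<in>I. l i)"
proof (induction I rule: infinite_finite_induct)
  case (insert i I)
  then have "double_limit (\<lambda>k \<epsilon>. a i k \<epsilon> + (\<Sum>i\<in>I. a i k \<epsilon>)) (l i + (\<Sum>i\<in>I. l i))"
    by (intro double_limit_add) auto
  with insert show ?case by simp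
qed (simp_all add: double_limit_def)

lemma double_limit_uniform_approx:
  assumes "\<And>\<tau>. \<tau> > 0 \<Longrightarrow> \<exists>b m. double_limit b m \<and> \<bar>m - l\<bar> \<le> \<tau> \<and> (\<forall>k \<epsilon>. \<bar>a k \<epsilon> - b k \<epsilon>\<bar> \<le> \<tau>)"
  shows "double_limit a l"
  unfolding double_limit_def
proof (intro allI impI)
  fix \<tau> :: real assume "\<tau> > 0"
  then have "\<tau> / 3 > 0" by simp
  from assms[OF this] obtain b m where
    b: "double_limit b m" "\<bar>m - l\<bar> \<le> \<tau> / 3" "\<And>k \<epsilon>. \<bar>a k \<epsilon> - b k \<epsilon>\<bar> \<le> \<tau> / 3" by blast
  have "\<forall>\<^sub>F \<epsilon> in at_right 0. \<forall>\<^sub>F k in sequentially. \<bar>b k \<epsilon> - m\<bar> < \<tau> / 3"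
    using b(1) \<open>\<tau> / 3 > 0\<close> unfolding double_limit_def by blast
  then show "\<forall>\<^sub>F \<epsilon> in at_right 0. \<forall>\<^sub>F k in sequentially. \<bar>a k \<epsilon> - l\<bar> < \<tau>"
  proof eventually_elim
    case (elim \<epsilon>)
    then show ?case
    proof eventually_elim
      case (elim k)
      show ?case using elim b(2) b(3)[of k \<epsilon>] by linarith
    qed
  qed
qed

text \<open>The two dominations are used asymmetrically. Since \<open>H\<close> decreases, domination of \<open>Z\<close> by \<open>W\<close> at a
  scale \<open>\<delta>\<close> chosen after \<open>\<epsilon>\<close> bounds the integrals for \<open>Z\<close> from below for every \<open>\<epsilon> > 0\<close>. The
  opposite domination is applied to one fixed good \<open>\<delta>\<close> and bounds them from above for small \<open>\<epsilon>\<close>.\<close>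

lemma double_limit_antimono_integral:
  fixes H :: "ennreal \<Rightarrow> real"
  assumes M: "prob_space M"
    and H: "antimono H" "\<And>z. 0 \<le> H z" "\<And>z. H z \<le> 1" "H \<in> borel_measurable borel"
    and Z: "\<And>k \<epsilon>. Z k \<epsilon> \<in> borel_measurable M" and W: "\<And>k \<epsilon>. W k \<epsilon> \<in> borel_measurable M"
    and ZW: "asymptotically_dominated M Z W" and WZ: "asymptotically_dominated M W Z"
    and lim: "double_limit (\<lambda>k \<epsilon>. \<integral>x. H (ennreal (W k \<epsilon> x)) \<partial>M) l"
  shows "double_limit (\<lambda>k \<epsilon>. \<integral>x. H (ennreal (Z k \<epsilon> x)) \<partial>M) l"
  unfolding double_limit_def
proof (intro allI impI)
  fix \<tau> :: real assume "\<tau> > 0"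
  define I where "I V k \<epsilon> = (\<integral>x. H (ennreal (V k \<epsilon> x)) \<partial>M)" for V :: "nat \<Rightarrow> real \<Rightarrow> 'a \<Rightarrow> real" and k \<epsilon>
  have \<tau>2: "\<tau> / 2 > 0" using \<open>\<tau> > 0\<close> by simp
  have limW: "\<forall>\<^sub>F \<delta> in at_right 0. \<forall>\<^sub>F k in sequentially. \<bar>I W k \<delta> - l\<bar> < \<tau> / 2"
    using lim \<tau>2 unfolding double_limit_def I_def by blast
  have lower: "\<forall>\<^sub>F k in sequentially. l - \<tau> < I Z k \<epsilon>" if "\<epsilon> > 0" for \<epsilon>
  proof -
    have "\<forall>\<^sub>F \<delta> in at_right 0. \<forall>\<^sub>F k in sequentially. measure M {x \<in> space M. W k \<delta> x < Z k \<epsilon> x} \<le> \<tau> / 2"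
      using ZW \<open>\<epsilon> > 0\<close> \<tau>2 unfolding asymptotically_dominated_def by blast
    with limW obtain \<delta> where
      "\<forall>\<^sub>F k in sequentially. \<bar>I W k \<delta> - l\<bar> < \<tau> / 2"
      "\<forall>\<^sub>F k in sequentially. measure M {x \<in> space M. W k \<delta> x < Z k \<epsilon> x} \<le> \<tau> / 2"
      using eventually_happens'[OF trivial_limit_at_right_real eventually_conj] by blast
    then show ?thesis
    proof eventually_elim
      case (elim k)
      have "I W k \<delta> \<le> I Z k \<epsilon> + measure M {x \<in> space M. W k \<delta> x < Z k \<epsilon> x}"
        unfolding I_def by (rule integral_antimono_le[OF M H Z W])
      with elim show ?case by linarith
    qed
  qed
  obtain \<delta> where \<delta>: "\<delta> > 0" "\<forall>\<^sub>F k in sequentially. \<bar>I W k \<delta> - l\<bar> < \<tau> / 2"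
    using eventually_happens'[OF trivial_limit_at_right_real eventually_conj[OF eventually_at_right_less limW]]
    by blast
  have "\<forall>\<^sub>F \<epsilon> in at_right 0. \<forall>\<^sub>F k in sequentially. measure M {x \<in> space M. Z k \<epsilon> x < W k \<delta> x} \<le> \<tau> / 2"
    using WZ \<delta>(1) \<tau>2 unfolding asymptotically_dominated_def by blast
  with eventually_at_right_less
  show "\<forall>\<^sub>F \<epsilon> in at_right 0. \<forall>\<^sub>F k in sequentially. \<bar>(\<integral>x. H (ennreal (Z k \<epsilon> x)) \<partial>M) - l\<bar> < \<tau>"
    unfolding I_def[symmetric]
  proof eventually_elim
    case (elim \<epsilon>)
    from elim(2) \<delta>(2) lower[OF elim(1)] show ?case
    proof eventually_elim
      case (elim k)
      have "I Z k \<epsilon> \<le> I W k \<delta> + measure M {x \<in> space M. Z k \<epsilon> x < W k \<delta> x}"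
        unfolding I_def by (rule integral_antimono_le[OF M H W Z])
      with elim show ?case by linarith
    qed
  qed
qed

text \<open>The decreasing homeomorphism \<open>z \<mapsto> 1 / (1 + z)\<close> of \<open>[0,\<infinity>]\<close> onto \<open>[0,1]\<close>. The decreasing choice has
  the inverse \<open>v \<mapsto> 1 / v - 1\<close>, whose continuity, also at \<open>v = 0\<close>, is directly that of inversion.\<close>

definition compactify :: "ennreal \<Rightarrow> real" where
  "compactify z = enn2real (inverse (1 + z))"

lemma ennreal_inverse_antimono:
  fixes x y :: ennreal
  assumes "x \<le> y"
  shows "inverse y \<le> inverse x"
  using assms including ennreal.lifting by transfer (rule ereal_inverse_antimono)

lemma ennreal_inverse_inverse: "inverse (inverse x) = (x :: ennreal)"
proof (cases x)
  case (real r)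
  then show ?thesis by (cases "r = 0") (auto simp: inverse_ennreal)
qed simp

lemma inverse_one_plus_le_one: "inverse (1 + z :: ennreal) \<le> 1"
  using ennreal_inverse_antimono[of 1 "1 + z"] by simp

lemma ennreal_compactify: "ennreal (compactify z) = inverse (1 + z)"
  unfolding compactify_def using inverse_one_plus_le_one[of z]
  by (intro ennreal_enn2real) (auto simp: less_top[symmetric] top_unique)

lemma compactify_nonneg: "0 \<le> compactify z"
  by (simp add: compactify_def)

lemma compactify_le_one: "compactify z \<le> 1"
  using inverse_one_plus_le_one[of z] unfolding ennreal_compactify[symmetric]
  by (simp add: compactify_nonneg)

lemma antimono_compactify: "antimono compactify"
proof (rule antimonoI)
  fix y z :: ennreal assume "y \<le> z"
  then have "inverse (1 + z) \<le> inverse (1 + y)"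
    by (intro ennreal_inverse_antimono add_left_mono)
  then show "compactify z \<le> compactify y"
    unfolding ennreal_compactify[symmetric] by (simp add: compactify_nonneg)
qed

lemma continuous_on_compactify: "continuous_on UNIV compactify"
  unfolding continuous_on_def
proof
  fix z :: ennreal
  have "continuous_on UNIV (\<lambda>z::ennreal. inverse (1 + z))"
    by (intro continuous_on_inverse_ennreal continuous_on_add_ennreal continuous_on_const continuous_on_id)
  then have "((\<lambda>z. inverse (1 + z)) \<longlongrightarrow> ennreal (compactify z)) (at z)"
    unfolding ennreal_compactify by (simp add: continuous_on_def)
  then show "(compactify \<longlongrightarrow> compactify z) (at z)"
    unfolding compactify_def[abs_def] by (rule tendsto_enn2real) simp
qed

lemma compactify_measurable [measurable]: "compactify \<in> borel_measurable borel"
  by (rule borel_measurable_continuous_onI) (rule continuous_on_compactify)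

text \<open>Weierstrass approximation on \<open>[0,1]\<close>, transported by the coordinate \<^const>\<open>compactify\<close>.\<close>

lemma continuous_ennreal_polynomial_approx:
  fixes g :: "ennreal \<Rightarrow> real"
  assumes g: "continuous_on UNIV g" and "\<tau> > 0"
  obtains a r where "\<And>z. \<bar>g z - (\<Sum>i\<le>r. a i * compactify z ^ i)\<bar> \<le> \<tau>"
proof -
  define f where "f v = g (inverse (ennreal v) - 1)" for v
  have "continuous_on {0..1} (\<lambda>v. inverse (ennreal v) - 1)"
    unfolding continuous_on_def
  proof (intro ballI tendsto_diff_ennreal_general tendsto_const)
    fix v :: real
    have "continuous_on {0..1} (\<lambda>v. inverse (ennreal v))"
      by (intro continuous_on_inverse_ennreal continuous_on_ennreal continuous_on_id)
    moreover assume "v \<in> {0..1}"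
    ultimately show "((\<lambda>v. inverse (ennreal v)) \<longlongrightarrow> inverse (ennreal v)) (at v within {0..1})"
      by (simp add: continuous_on_def)
  qed simp
  then have "continuous_on {0..1} f"
    unfolding f_def by (intro continuous_on_compose2[OF g]) auto
  then obtain p where p: "real_polynomial_function p" "\<And>v. v \<in> {0..1} \<Longrightarrow> \<bar>f v - p v\<bar> < \<tau>"
    using Stone_Weierstrass_real_polynomial_function[of "{0..1::real}" f \<tau>] \<open>\<tau> > 0\<close> by auto
  obtain a r where ar: "p = (\<lambda>v. \<Sum>i\<le>r. a i * v ^ i)"
    using p(1) by (auto simp: real_polynomial_function_iff_sum)
  have "f (compactify z) = g z" for z
    by (simp add: f_def ennreal_compactify ennreal_inverse_inverse)
  then have "\<bar>g z - (\<Sum>i\<le>r. a i * compactify z ^ i)\<bar> \<le> \<tau>" for z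
    using p(2)[of "compactify z"] by (simp add: ar compactify_nonneg compactify_le_one less_imp_le)
  then show thesis by (rule that)
qed

lemma integral_polynomial_approx:
  fixes g :: "ennreal \<Rightarrow> real"
  assumes "prob_space M" and V [measurable]: "V \<in> borel_measurable M" and g: "continuous_on UNIV g"
    and approx: "\<And>z. \<bar>g z - (\<Sum>i\<le>r. a i * compactify z ^ i)\<bar> \<le> \<tau>"
  shows "\<bar>(\<integral>x. g (V x) \<partial>M) - (\<Sum>i\<le>r. a i * (\<integral>x. compactify (V x) ^ i \<partial>M))\<bar> \<le> \<tau>"
proof -
  interpret prob_space M by fact
  have [measurable]: "g \<in> borel_measurable borel" using g by (rule borel_measurable_continuous_onI)
  define p where "p z = (\<Sum>i\<le>r. a i * compactify z ^ i)" for z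
  have [measurable]: "p \<in> borel_measurable borel" unfolding p_def[abs_def] by measurable
  have int: "integrable M (\<lambda>x. compactify (V x) ^ i)" for i
    by (intro integrable_const_bound[where B = 1])
      (auto simp: compactify_nonneg compactify_le_one power_le_one)
  have intp: "integrable M (\<lambda>x. p (V x))" unfolding p_def using int by simp
  have intd: "integrable M (\<lambda>x. g (V x) - p (V x))"
    using approx by (intro integrable_const_bound[where B = \<tau>]) (auto simp: p_def)
  have "integrable M (\<lambda>x. (g (V x) - p (V x)) + p (V x))"
    using intd intp by (rule Bochner_Integration.integrable_add)
  then have intg: "integrable M (\<lambda>x. g (V x))" by simp
  have "(\<integral>x. p (V x) \<partial>M) = (\<Sum>i\<le>r. a i * (\<integral>x. compactify (V x) ^ i \<partial>M))"
    unfolding p_def using int by simp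
  moreover have "(\<integral>x. g (V x) - p (V x) \<partial>M) = (\<integral>x. g (V x) \<partial>M) - (\<integral>x. p (V x) \<partial>M)"
    using intg intp by (rule Bochner_Integration.integral_diff)
  moreover have "\<bar>\<integral>x. g (V x) - p (V x) \<partial>M\<bar> \<le> (\<integral>x. \<bar>g (V x) - p (V x)\<bar> \<partial>M)"
    by (rule integral_abs_bound)
  moreover have "(\<integral>x. \<bar>g (V x) - p (V x)\<bar> \<partial>M) \<le> (\<integral>x. \<tau> \<partial>M)"
    using intd approx by (intro integral_mono) (auto simp: p_def)
  ultimately show ?thesis by (simp add: prob_space)
qed

text \<open>Monotone test functions are handled by \<open>double_limit_antimono_integral\<close>. The powers of
  \<^const>\<open>compactify\<close> are such functions, and their linear combinations are uniformly dense in the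
  continuous functions.\<close>

lemma tends_in_distr_dominated:
  assumes M: "prob_space M" and N: "prob_space N" and Y: "Y \<in> borel_measurable N"
    and Z: "\<And>k \<epsilon>. Z k \<epsilon> \<in> borel_measurable M" and W: "\<And>k \<epsilon>. W k \<epsilon> \<in> borel_measurable M"
    and ZW: "asymptotically_dominated M Z W" and WZ: "asymptotically_dominated M W Z"
    and lim: "tends_in_distr M W N Y"
  shows "tends_in_distr M Z N Y"
  unfolding tends_in_distr_iff
proof (intro allI impI)
  fix g :: "ennreal \<Rightarrow> real" assume g: "continuous_on UNIV g"
  have lim': "double_limit (\<lambda>k \<epsilon>. \<integral>x. compactify (ennreal (Z k \<epsilon> x)) ^ i \<partial>M) (\<integral>y. compactify (Y y) ^ i \<partial>N)" for i
  proof (rule double_limit_antimono_integral[OF M _ _ _ _ Z W ZW WZ])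
    show "antimono (\<lambda>z. compactify z ^ i)"
      by (intro antimonoI power_mono antimonoD[OF antimono_compactify] compactify_nonneg)
    have "continuous_on UNIV (\<lambda>z. compactify z ^ i)"
      by (intro continuous_on_power continuous_on_compactify)
    then show "double_limit (\<lambda>k \<epsilon>. \<integral>x. compactify (ennreal (W k \<epsilon> x)) ^ i \<partial>M) (\<integral>y. compactify (Y y) ^ i \<partial>N)"
      using lim[unfolded tends_in_distr_iff, rule_format, of "\<lambda>z. compactify z ^ i"] by simp
  qed (auto simp: compactify_nonneg compactify_le_one power_le_one)
  show "double_limit (\<lambda>k \<epsilon>. \<integral>x. g (ennreal (Z k \<epsilon> x)) \<partial>M) (\<integral>y. g (Y y) \<partial>N)"
  proof (rule double_limit_uniform_approx)
    fix \<tau> :: real assume "\<tau> > 0"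
    then obtain a r where ar: "\<And>z. \<bar>g z - (\<Sum>i\<le>r. a i * compactify z ^ i)\<bar> \<le> \<tau>"
      using continuous_ennreal_polynomial_approx[OF g] by blast
    let ?b = "\<lambda>k \<epsilon>. \<Sum>i\<le>r. a i * (\<integral>x. compactify (ennreal (Z k \<epsilon> x)) ^ i \<partial>M)"
    let ?m = "\<Sum>i\<le>r. a i * (\<integral>y. compactify (Y y) ^ i \<partial>N)"
    have "double_limit ?b ?m" by (intro double_limit_sum double_limit_cmult lim')
    moreover have "\<bar>?m - (\<integral>y. g (Y y) \<partial>N)\<bar> \<le> \<tau>"
      using integral_polynomial_approx[OF N Y g ar] by (simp add: abs_minus_commute)
    moreover have "\<bar>(\<integral>x. g (ennreal (Z k \<epsilon> x)) \<partial>M) - ?b k \<epsilon>\<bar> \<le> \<tau>" for k \<epsilon>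
      by (rule integral_polynomial_approx[OF M _ g ar]) (use Z in measurable)
    ultimately show "\<exists>b m. double_limit b m \<and> \<bar>m - (\<integral>y. g (Y y) \<partial>N)\<bar> \<le> \<tau>
        \<and> (\<forall>k \<epsilon>. \<bar>(\<integral>x. g (ennreal (Z k \<epsilon> x)) \<partial>M) - b k \<epsilon>\<bar> \<le> \<tau>)"
      by blast
  qed
qed

section \<open>Coding by a generator\<close>

lemma cell_eqI:
  assumes "partition_on X P" "A \<in> P" "x \<in> A"
  shows "cell P x = A"
  unfolding cell_def using assms partition_onD2[OF assms(1)]
  by (intro the_equality) (auto dest: disjointD)

lemma cell_in_partition:
  assumes "partition_on X P" "x \<in> X"
  shows "cell P x \<in> P" and "x \<in> cell P x"
proof -
  obtain A where A: "A \<in> P" "x \<in> A"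
    using assms partition_onD1 by (metis UnionE)
  have "cell P x = A" by (rule cell_eqI[OF assms(1) A])
  with A show "cell P x \<in> P" "x \<in> cell P x" by simp_all
qed

locale mpt_subalgebra = prob_space M for M :: "'a measure" +
  fixes T :: "'a \<Rightarrow> 'a" and C :: "'a measure"
  assumes invertible: "invertible_mpt M T" and subalg: "subalgebra M C"
begin

lemma funpow_in_space:
  assumes "f \<in> M \<rightarrow>\<^sub>M M" "x \<in> space M"
  shows "(f ^^ k) x \<in> space M"
  using assms by (induction k) (auto dest: measurable_space)

lemma funpow_measurable:
  assumes "f \<in> M \<rightarrow>\<^sub>M M"
  shows "(f ^^ k) \<in> M \<rightarrow>\<^sub>M M"
  using assms by (induction k) (auto intro: measurable_comp)

lemma T_measurable [measurable]: "T \<in> M \<rightarrow>\<^sub>M M"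
  and inv_T_measurable [measurable]: "inv_into (space M) T \<in> M \<rightarrow>\<^sub>M M"
  and T_bij: "bij_betw T (space M) (space M)"
  and distr_T: "distr M M T = M"
  using invertible by (auto simp: invertible_mpt_def)

lemmas T_iterate_measurable [measurable] = funpow_measurable[OF T_measurable]
lemmas T_iterate_in_space = funpow_in_space[OF T_measurable]
lemmas inv_T_iterate_in_space = funpow_in_space[OF inv_T_measurable]

lemma distr_T_iterate: "distr M M (T ^^ k) = M"
proof (induction k)
  case 0
  show ?case by (simp add: distr_id id_def)
next
  case (Suc k)
  have "distr M M (T ^^ Suc k) = distr (distr M M (T ^^ k)) M T"
    unfolding funpow.simps(2) by (rule distr_distr[symmetric]) measurable
  then show ?case by (simp only: Suc distr_T)
qed

lemma inv_T_T: "x \<in> space M \<Longrightarrow> inv_into (space M) T (T x) = x"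
  and T_inv_T: "x \<in> space M \<Longrightarrow> T (inv_into (space M) T x) = x"
  using T_bij by (auto intro: bij_betw_inv_into_left bij_betw_inv_into_right)

lemma inv_T_iterate_T_iterate:
  assumes "x \<in> space M" "m \<le> k"
  shows "(inv_into (space M) T ^^ m) ((T ^^ k) x) = (T ^^ (k - m)) x"
  using assms(2)
proof (induction m)
  case (Suc m)
  then have "T ^^ (k - m) = T \<circ> T ^^ (k - Suc m)"
    by (metis Suc_diff_Suc Suc_le_lessD funpow.simps(2))
  with Suc show ?case
    using inv_T_T[OF T_iterate_in_space[OF assms(1)]] by simp
qed simp

lemma T_iterate_inv_T_iterate:
  assumes "x \<in> space M"
  shows "(T ^^ k) ((inv_into (space M) T ^^ k) x) = x"
proof (induction k)
  case (Suc k)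
  have "(T ^^ Suc k) ((inv_into (space M) T ^^ Suc k) x)
      = (T ^^ k) (T (inv_into (space M) T ((inv_into (space M) T ^^ k) x)))"
    by (simp add: funpow_swap1)
  then show ?case
    using Suc T_inv_T[OF inv_T_iterate_in_space[OF assms]] by simp
qed simp

lemma int_iterate_in_space: "x \<in> space M \<Longrightarrow> int_iterate M T i x \<in> space M"
  by (simp add: int_iterate_def T_iterate_in_space inv_T_iterate_in_space)

lemma int_iterate_measurable [measurable]: "int_iterate M T i \<in> M \<rightarrow>\<^sub>M M"
  unfolding int_iterate_def by (auto intro: funpow_measurable)

lemma int_iterate_minus: "x \<in> space M \<Longrightarrow> int_iterate M T (- i) (int_iterate M T i x) = x"
  using inv_T_iterate_T_iterate[of x "nat i" "nat i"] T_iterate_inv_T_iterate[of x "nat (- i)"]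
  by (auto simp: int_iterate_def)

text \<open>The condition keeps the total time nonnegative, so that names around time \<open>k\<close> are read off the
  forward orbit, which is all that the Hamming distance sees.\<close>

lemma int_iterate_T_iterate:
  assumes "x \<in> space M" "0 \<le> int k + i"
  shows "int_iterate M T i ((T ^^ k) x) = (T ^^ nat (int k + i)) x"
proof (cases "i \<ge> 0")
  case True
  then have "nat (int k + i) = nat i + k" by (simp add: nat_add_distrib)
  with True show ?thesis by (simp add: int_iterate_def funpow_add)
next
  case False
  then have "nat (int k + i) = k - nat (- i)" "nat (- i) \<le> k" using assms by auto
  with False show ?thesis
    by (simp add: int_iterate_def inv_T_iterate_T_iterate[OF assms(1)])
qed

lemma int_iterate_image:
  assumes "S \<subseteq> space M"
  shows "int_iterate M T i ` S = int_iterate M T (- i) -` S \<inter> space M"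
proof safe
  fix x assume "x \<in> S"
  then show "int_iterate M T i x \<in> int_iterate M T (- i) -` S" "int_iterate M T i x \<in> space M"
    using assms by (auto simp: int_iterate_minus int_iterate_in_space)
next
  fix x assume "int_iterate M T (- i) x \<in> S" "x \<in> space M"
  then show "x \<in> int_iterate M T i ` S"
    using int_iterate_minus[of x "- i"] by (metis image_eqI minus_minus)
qed

definition same_names :: "'a set set \<Rightarrow> nat \<Rightarrow> 'a \<Rightarrow> 'a \<Rightarrow> bool" where
  "same_names P N x y \<longleftrightarrow>
     (\<forall>i. \<bar>i\<bar> \<le> int N \<longrightarrow> cell P (int_iterate M T i x) = cell P (int_iterate M T i y))"

text \<open>The sets determined by the \<open>P\<close>-names over the window \<open>-N, ..., N\<close>: inside the space, unions of
  elements of the join of the translates of \<open>P\<close> over the window. Measurability is kept apart, because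
  complements and unions then preserve the property trivially.\<close>

definition determined :: "'a set set \<Rightarrow> nat \<Rightarrow> 'a set \<Rightarrow> bool" where
  "determined P N A \<longleftrightarrow>
     (\<forall>x\<in>space M. \<forall>y\<in>space M. same_names P N x y \<longrightarrow> (x \<in> A \<longleftrightarrow> y \<in> A))"

lemma same_names_mono: "same_names P N x y \<Longrightarrow> N' \<le> N \<Longrightarrow> same_names P N' x y"
  unfolding same_names_def by force

lemma determined_mono: "determined P N A \<Longrightarrow> N \<le> N' \<Longrightarrow> determined P N' A"
  unfolding determined_def using same_names_mono by blast

lemma determined_UN: "(\<And>i. i \<in> I \<Longrightarrow> determined P N (A i)) \<Longrightarrow> determined P N (\<Union>i\<in>I. A i)"
  unfolding determined_def by blast

lemma sigma_sets_names_measurable: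
  assumes "countable_partition M P"
    and "A \<in> sigma_sets (space M) (\<Union>i. (\<lambda>S. int_iterate M T i ` S) ` P)"
  shows "A \<in> sets M"
proof -
  have "int_iterate M T i ` S \<in> sets M" if "S \<in> P" for i S
  proof -
    have "S \<in> sets M" using that assms(1) by (auto simp: countable_partition_def)
    then show ?thesis
      by (simp add: int_iterate_image sets.sets_into_space) measurable
  qed
  then have "(\<Union>i. (\<lambda>S. int_iterate M T i ` S) ` P) \<subseteq> sets M" by auto
  from sets.sigma_sets_subset[OF this] assms(2) show ?thesis by auto
qed

lemma measure_UN_minus_finite_UN_small:
  fixes A :: "nat \<Rightarrow> 'a set"
  assumes "\<And>i. A i \<in> sets M" "\<eta> > 0"
  obtains r where "measure M ((\<Union>i. A i) - (\<Union>i<r. A i)) < \<eta>"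
proof -
  have "(\<lambda>r. measure M ((\<Union>i. A i) - (\<Union>i<r. A i))) \<longlonglongrightarrow> measure M (\<Inter>r. (\<Union>i. A i) - (\<Union>i<r. A i))"
    using assms(1) by (intro finite_Lim_measure_decseq) (auto simp: decseq_def)
  also have "(\<Inter>r. (\<Union>i. A i) - (\<Union>i<r. A i)) = {}" by auto
  finally have "(\<lambda>r. measure M ((\<Union>i. A i) - (\<Union>i<r. A i))) \<longlonglongrightarrow> 0" by simp
  from order_tendstoD(2)[OF this \<open>\<eta> > 0\<close>] that show thesis
    by (auto simp: eventually_sequentially)
qed

text \<open>A countable union is nearly a finite one, and finitely many windows have a largest one.\<close>

lemma measure_sym_diff_Union_approx:
  fixes A :: "nat \<Rightarrow> 'a set"
  assumes meas: "\<And>i. A i \<in> sets M" and "\<eta> > 0"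
    and approx: "\<And>i \<eta>. \<eta> > 0 \<Longrightarrow> \<exists>N B. B \<in> sets M \<and> determined P N B \<and> measure M (sym_diff (A i) B) < \<eta>"
  shows "\<exists>N B. B \<in> sets M \<and> determined P N B \<and> measure M (sym_diff (\<Union>i. A i) B) < \<eta>"
proof -
  obtain r where r: "measure M ((\<Union>i. A i) - (\<Union>i<r. A i)) < \<eta> / 2"
    using measure_UN_minus_finite_UN_small[of A "\<eta> / 2"] meas \<open>\<eta> > 0\<close> by auto
  \<comment> \<open>\<open>Suc r\<close> instead of \<open>r\<close> avoids a case distinction for \<open>r = 0\<close>.\<close>
  define \<eta>' where "\<eta>' = \<eta> / (2 * real (Suc r))"
  have "\<eta>' > 0" using \<open>\<eta> > 0\<close> by (simp add: \<eta>'_def)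
  from approx[OF this] obtain N B where
    NB: "\<And>i. B i \<in> sets M" "\<And>i. determined P (N i) (B i)" "\<And>i. measure M (sym_diff (A i) (B i)) < \<eta>'"
    by metis
  define N' where "N' = Max (N ` {..r})"
  have "determined P N' (\<Union>i<r. B i)"
    by (intro determined_UN) (auto simp: N'_def intro!: determined_mono[OF NB(2)])
  moreover have "(\<Union>i<r. B i) \<in> sets M" using NB(1) by auto
  moreover have "measure M (sym_diff (\<Union>i. A i) (\<Union>i<r. B i)) < \<eta>"
  proof -
    have "measure M (sym_diff (\<Union>i. A i) (\<Union>i<r. B i))
        \<le> measure M (((\<Union>i. A i) - (\<Union>i<r. A i)) \<union> (\<Union>i<r. sym_diff (A i) (B i)))"
      using meas NB(1) by (intro finite_measure_mono) auto
    also have "\<dots> \<le> measure M ((\<Union>i. A i) - (\<Union>i<r. A i)) + measure M (\<Union>i<r. sym_diff (A i) (B i))"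
      using meas NB(1) by (intro measure_Un_le) auto
    also have "measure M (\<Union>i<r. sym_diff (A i) (B i)) \<le> (\<Sum>i<r. measure M (sym_diff (A i) (B i)))"
      using meas NB(1) by (intro finite_measure_subadditive_finite) auto
    also have "\<dots> \<le> (\<Sum>i<r. \<eta>')" using NB(3) by (intro sum_mono less_imp_le)
    also have "\<dots> \<le> \<eta> / 2" using \<open>\<eta> > 0\<close> by (simp add: \<eta>'_def field_simps)
    finally show ?thesis using r by simp
  qed
  ultimately show ?thesis by blast
qed

text \<open>The sets that can be approximated by determined sets contain the translates of the cells and are
  closed under complements and countable unions.\<close>

lemma sigma_sets_approx_determined:
  assumes P: "countable_partition M P"
    and A: "A \<in> sigma_sets (space M) (\<Union>i. (\<lambda>S. int_iterate M T i ` S) ` P)"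
    and "\<eta> > 0"
  shows "\<exists>N B. B \<in> sets M \<and> determined P N B \<and> measure M (sym_diff A B) < \<eta>"
  using A \<open>\<eta> > 0\<close>
proof (induction arbitrary: \<eta> rule: sigma_sets.induct)
  case (Basic A)
  then obtain i S where A: "A = int_iterate M T i ` S" and S: "S \<in> P" by auto
  have part: "partition_on (space M) P" and "S \<subseteq> space M"
    using S P by (auto simp: countable_partition_def partition_on_def)
  have "determined P (nat \<bar>i\<bar>) A"
    unfolding determined_def
  proof (intro ballI impI)
    fix x y assume xy: "x \<in> space M" "y \<in> space M" "same_names P (nat \<bar>i\<bar>) x y"
    have "cell P (int_iterate M T (- i) x) = cell P (int_iterate M T (- i) y)"
      using xy(3) by (auto simp: same_names_def)
    moreover have "z \<in> A \<longleftrightarrow> cell P (int_iterate M T (- i) z) = S" if "z \<in> space M" for z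
      using cell_eqI[OF part S] cell_in_partition[OF part int_iterate_in_space[OF that]] that
      by (auto simp: A int_iterate_image[OF \<open>S \<subseteq> space M\<close>])
    ultimately show "x \<in> A \<longleftrightarrow> y \<in> A" using xy by simp
  qed
  moreover have "A \<in> sets M"
    using Basic by (intro sigma_sets_names_measurable[OF P]) auto
  ultimately show ?case using Basic by (intro exI[of _ "nat \<bar>i\<bar>"] exI[of _ A]) simp
next
  case Empty
  then show ?case by (intro exI[of _ 0] exI[of _ "{}"]) (simp add: determined_def)
next
  case (Compl A)
  then obtain N B where B: "B \<in> sets M" "determined P N B" "measure M (sym_diff A B) < \<eta>" by blast
  have "A \<subseteq> space M"
    using sigma_sets_names_measurable[OF P Compl(1)] by (rule sets.sets_into_space)
  moreover have "B \<subseteq> space M" using B(1) by (rule sets.sets_into_space)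
  ultimately have "sym_diff (space M - A) (space M - B) = sym_diff A B" by auto
  moreover have "determined P N (space M - B)" using B(2) by (auto simp: determined_def)
  ultimately show ?case using B by (intro exI[of _ N] exI[of _ "space M - B"]) auto
next
  case (Union A)
  show ?case
    using sigma_sets_names_measurable[OF P Union(1)] Union(2,3)
    by (intro measure_sym_diff_Union_approx) auto
qed

lemma generator_approx_determined:
  assumes P: "generator M T P" and A: "A \<in> sets M" and "\<eta> > 0"
  shows "\<exists>N B. B \<in> sets M \<and> determined P N B \<and> measure M (sym_diff A B) < \<eta>"
proof -
  obtain A' where A': "A' \<in> sigma_sets (space M) (\<Union>i. (\<lambda>S. int_iterate M T i ` S) ` P)"
      and null: "emeasure M (sym_diff A A') = 0"
    using P A by (auto simp: generator_def)
  have part: "countable_partition M P" using P by (simp add: generator_def)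
  obtain N B where B: "B \<in> sets M" "determined P N B" "measure M (sym_diff A' B) < \<eta>"
    using sigma_sets_approx_determined[OF part A' \<open>\<eta> > 0\<close>] by blast
  have [measurable]: "A \<in> sets M" "A' \<in> sets M" "B \<in> sets M"
    using A B sigma_sets_names_measurable[OF part A'] by auto
  have "measure M (sym_diff A B) \<le> measure M (sym_diff A A' \<union> sym_diff A' B)"
    by (intro finite_measure_mono) auto
  also have "\<dots> \<le> measure M (sym_diff A A') + measure M (sym_diff A' B)"
    by (intro measure_Un_le) auto
  also have "measure M (sym_diff A A') = 0" using null by (simp add: measure_def)
  finally have "measure M (sym_diff A B) < \<eta>" using B(3) by simp
  with B show ?thesis by blast
qed

text \<open>Finitely many cells of \<open>Q\<close> fill the space up to a small set. Approximate each of them by a determined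
  set, and let \<open>B\<close> collect the remaining cells and all approximation errors. Two points outside \<open>B\<close> with
  the same \<open>P\<close>-names lie in the same approximating sets, hence in the same cell.\<close>

lemma generator_coding:
  assumes P: "generator M T P" and Q: "countable_partition M Q" and "\<eta> > 0"
  shows "\<exists>N. \<exists>B\<in>sets M. measure M B < \<eta> \<and>
    (\<forall>x\<in>space M - B. \<forall>y\<in>space M - B. same_names P N x y \<longrightarrow> cell Q x = cell Q y)"
proof -
  have part: "partition_on (space M) Q" and Qm: "\<And>A. A \<in> Q \<Longrightarrow> A \<in> sets M" and cQ: "countable Q"
    using Q by (auto simp: countable_partition_def)
  have ne: "Q \<noteq> {}" using partition_onD1[OF part] not_empty by auto
  define A where "A = from_nat_into Q"
  have AQ: "A i \<in> Q" for i unfolding A_def by (rule from_nat_into[OF ne])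
  have [measurable]: "A i \<in> sets M" for i using AQ Qm by blast
  have UA: "(\<Union>i. A i) = space M"
    using partition_onD1[OF part] range_from_nat_into[OF ne cQ] by (simp add: A_def)
  obtain r where "measure M ((\<Union>i. A i) - (\<Union>i<r. A i)) < \<eta> / 2"
    using measure_UN_minus_finite_UN_small[of A "\<eta> / 2"] \<open>\<eta> > 0\<close> by auto
  then have r: "measure M (space M - (\<Union>i<r. A i)) < \<eta> / 2" by (simp only: UA)
  \<comment> \<open>\<open>Suc r\<close> instead of \<open>r\<close> avoids a case distinction for \<open>r = 0\<close>.\<close>
  define \<eta>' where "\<eta>' = \<eta> / (2 * real (Suc r))"
  have "\<eta>' > 0" using \<open>\<eta> > 0\<close> by (simp add: \<eta>'_def)
  from generator_approx_determined[OF P _ this, of "A _"] obtain N D where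
    ND: "\<And>i. D i \<in> sets M" "\<And>i. determined P (N i) (D i)" "\<And>i. measure M (sym_diff (A i) (D i)) < \<eta>'"
    by (metis \<open>\<And>i. A i \<in> events\<close>)
  define B where "B = (space M - (\<Union>i<r. A i)) \<union> (\<Union>i<r. sym_diff (A i) (D i))"
  have [measurable]: "B \<in> sets M" unfolding B_def using ND(1) by auto
  have "measure M B \<le> measure M (space M - (\<Union>i<r. A i)) + measure M (\<Union>i<r. sym_diff (A i) (D i))"
    unfolding B_def using ND(1) by (intro measure_Un_le) auto
  also have "measure M (\<Union>i<r. sym_diff (A i) (D i)) \<le> (\<Sum>i<r. measure M (sym_diff (A i) (D i)))"
    using ND(1) by (intro finite_measure_subadditive_finite) auto
  also have "\<dots> \<le> (\<Sum>i<r. \<eta>')" using ND(3) by (intro sum_mono less_imp_le)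
  also have "\<dots> \<le> \<eta> / 2" using \<open>\<eta> > 0\<close> by (simp add: \<eta>'_def field_simps)
  finally have "measure M B < \<eta>" using r by simp
  moreover have "cell Q x = cell Q y"
    if xy: "x \<in> space M - B" "y \<in> space M - B" "same_names P (Max (N ` {..r})) x y" for x y
  proof -
    obtain i where i: "i < r" "x \<in> A i" using xy(1) by (auto simp: B_def)
    have "determined P (Max (N ` {..r})) (D i)"
      using i by (auto intro!: determined_mono[OF ND(2)])
    then have "x \<in> D i \<longleftrightarrow> y \<in> D i" using xy by (auto simp: determined_def)
    then have "y \<in> A i" using i xy by (auto simp: B_def)
    then show ?thesis using cell_eqI[OF part AQ] i by metis
  qed
  ultimately show ?thesis using \<open>B \<in> sets M\<close> by blast
qed

section \<open>Hamming distances and balls\<close>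

definition visit_freq :: "'a set \<Rightarrow> nat \<Rightarrow> 'a \<Rightarrow> real" where
  "visit_freq B n x = real (card {k. k < n \<and> (T ^^ k) x \<in> B}) / real n"

text \<open>If the \<open>Q\<close>-names of \<open>x\<close> and \<open>y\<close> differ at time \<open>k\<close>, then one of the points is in \<open>B\<close> at that time, or
  \<open>k\<close> is within \<open>N\<close> of an end of \<open>{0..<n}\<close>, or the \<open>P\<close>-names differ at some time \<open>m < n\<close> with
  \<open>\<bar>m - k\<bar> \<le> N\<close>; each such \<open>m\<close> accounts for at most \<open>2 N + 1\<close> values of \<open>k\<close>.\<close>

lemma hamming_dist_recode:
  assumes x: "x \<in> space M" and y: "y \<in> space M"
    and code: "\<And>x y. x \<in> space M - B \<Longrightarrow> y \<in> space M - B \<Longrightarrow> same_names P N x y \<Longrightarrow> cell Q x = cell Q y"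
  shows "hamming_dist T Q n x y \<le> (2 * real N + 1) * hamming_dist T P n x y + 2 * real N / real n
      + visit_freq B n x + visit_freq B n y"
proof -
  define D where "D R = {k. k < n \<and> cell R ((T ^^ k) x) \<noteq> cell R ((T ^^ k) y)}" for R
  define V where "V z = {k. k < n \<and> (T ^^ k) z \<in> B}" for z
  \<comment> \<open>The times within \<open>N\<close> of a time at which the \<open>P\<close>-names differ.\<close>
  define E where "E = (\<lambda>(m, i). nat (int m - i)) ` (D P \<times> {- int N .. int N})"
  have fin: "finite (D R)" "finite (V z)" for R z by (auto simp: D_def V_def)
  have "k \<in> V x \<union> V y \<union> {..<N} \<union> {n - N..<n} \<union> E" if k: "k \<in> D Q" for k
  proof (rule ccontr)
    assume neg: "\<not> ?thesis"
    have kn: "k < n" using k by (simp add: D_def)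
    have "(T ^^ k) x \<in> space M - B" "(T ^^ k) y \<in> space M - B"
      using neg kn x y by (auto simp: V_def T_iterate_in_space)
    then have "\<not> same_names P N ((T ^^ k) x) ((T ^^ k) y)"
      using code k by (auto simp: D_def)
    then obtain i where i: "\<bar>i\<bar> \<le> int N"
        "cell P (int_iterate M T i ((T ^^ k) x)) \<noteq> cell P (int_iterate M T i ((T ^^ k) y))"
      by (auto simp: same_names_def)
    have ki: "0 \<le> int k + i" "nat (int k + i) < n" using neg kn i(1) by auto
    have "nat (int k + i) \<in> D P"
      using i(2) ki x y by (simp add: int_iterate_T_iterate D_def)
    moreover have "k = nat (int (nat (int k + i)) - i)" using ki by simp
    ultimately have "k \<in> E"
      unfolding E_def using i(1) by (intro image_eqI[of _ _ "(nat (int k + i), i)"]) auto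
    with neg show False by simp
  qed
  then have "card (D Q) \<le> card (V x \<union> V y \<union> {..<N} \<union> {n - N..<n} \<union> E)"
    using fin by (intro card_mono subsetI) (simp_all add: E_def)
  also have "\<dots> \<le> card (V x) + card (V y) + card {..<N} + card {n - N..<n} + card E"
    by (intro order_trans[OF card_Un_le] add_mono le_refl)
  also have "\<dots> \<le> card (V x) + card (V y) + 2 * N + card E" by simp
  finally have "card (D Q) \<le> card (V x) + card (V y) + 2 * N + card E" .
  moreover have "card E \<le> card (D P \<times> {- int N .. int N})"
    unfolding E_def using fin by (intro card_image_le) simp
  moreover have "card (D P \<times> {- int N .. int N}) = card (D P) * (2 * N + 1)"
  proof -
    have "card {- int N .. int N} = 2 * N + 1" by simp
    then show ?thesis by (simp only: card_cartesian_product)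
  qed
  ultimately have "card (D Q) \<le> card (V x) + card (V y) + 2 * N + card (D P) * (2 * N + 1)"
    by linarith
  then have "real (card (D Q)) \<le> real (card (V x) + card (V y) + 2 * N + card (D P) * (2 * N + 1))"
    by (rule of_nat_mono)
  then have "real (card (D Q)) / n \<le> real (card (V x) + card (V y) + 2 * N + card (D P) * (2 * N + 1)) / n"
    by (intro divide_right_mono) auto
  then show ?thesis
    by (simp add: hamming_dist_def visit_freq_def D_def V_def add_divide_distrib algebra_simps)
qed

lemma hamming_dist_commute: "hamming_dist T P n x y = hamming_dist T P n y x"
proof -
  have "{k. k < n \<and> cell P ((T ^^ k) x) \<noteq> cell P ((T ^^ k) y)}
      = {k. k < n \<and> cell P ((T ^^ k) y) \<noteq> cell P ((T ^^ k) x)}"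
    by (auto simp del: funpow.simps)
  then show ?thesis by (simp only: hamming_dist_def)
qed

lemma hamming_dist_triangle: "hamming_dist T P n x z \<le> hamming_dist T P n x y + hamming_dist T P n y z"
proof -
  have "card {k. k < n \<and> cell P ((T ^^ k) x) \<noteq> cell P ((T ^^ k) z)}
    \<le> card ({k. k < n \<and> cell P ((T ^^ k) x) \<noteq> cell P ((T ^^ k) y)}
        \<union> {k. k < n \<and> cell P ((T ^^ k) y) \<noteq> cell P ((T ^^ k) z)})"
    by (rule card_mono) auto
  also have "\<dots> \<le> card {k. k < n \<and> cell P ((T ^^ k) x) \<noteq> cell P ((T ^^ k) y)}
        + card {k. k < n \<and> cell P ((T ^^ k) y) \<noteq> cell P ((T ^^ k) z)}"
    by (rule card_Un_le)
  finally show ?thesis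
    unfolding hamming_dist_def add_divide_distrib[symmetric] of_nat_add[symmetric]
    by (intro divide_right_mono) (simp_all only: of_nat_le_iff of_nat_0_le_iff)
qed

lemma visit_freq_nonneg: "visit_freq B n x \<ge> 0"
  by (simp add: visit_freq_def)

lemma visit_freq_eq_sum: "visit_freq B n x = (\<Sum>k<n. indicator B ((T ^^ k) x)) / real n"
proof -
  have "real (card {k. k < n \<and> (T ^^ k) x \<in> B}) = (\<Sum>k\<in>{k \<in> {..<n}. (T ^^ k) x \<in> B}. 1)"
    by simp
  also have "\<dots> = (\<Sum>k<n. if (T ^^ k) x \<in> B then 1 else 0)" by (rule sum.inter_filter) simp
  finally show ?thesis by (simp add: visit_freq_def indicator_def of_bool_def)
qed

lemma visit_freq_measurable [measurable]:
  assumes [measurable]: "B \<in> sets M"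
  shows "visit_freq B n \<in> borel_measurable M"
  unfolding visit_freq_eq_sum[abs_def] by measurable

text \<open>Markov's inequality; by invariance of the measure the mean of the visit frequency is that of \<open>B\<close>.\<close>

lemma measure_visit_freq_large:
  assumes [measurable]: "B \<in> sets M" and "\<beta> > 0" "n > 0"
  shows "measure M {x \<in> space M. visit_freq B n x \<ge> \<beta>} \<le> measure M B / \<beta>"
proof -
  have i: "integrable M (\<lambda>x. indicator B ((T ^^ k) x) :: real)" for k
    by (rule integrable_const_bound[where B = 1]) auto
  have "(\<integral>x. indicator B ((T ^^ k) x) \<partial>M) = measure M B" for k
  proof -
    have "(\<integral>x. indicator B ((T ^^ k) x) \<partial>M) = (\<integral>x. indicator B x \<partial>distr M M (T ^^ k) :: real)"
      by (subst integral_distr) auto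
    then show ?thesis by (simp add: distr_T_iterate)
  qed
  then have "(\<integral>x. visit_freq B n x \<partial>M) = measure M B"
    using i \<open>n > 0\<close> by (simp add: visit_freq_eq_sum)
  moreover have "integrable M (visit_freq B n)"
    unfolding visit_freq_eq_sum[abs_def] using i by simp
  moreover have "measure M {x \<in> space M. visit_freq B n x \<ge> \<beta>} \<le> (\<integral>x. visit_freq B n x \<partial>M) / \<beta>"
    using \<open>\<beta> > 0\<close> \<open>integrable M (visit_freq B n)\<close> visit_freq_nonneg
    by (intro integral_Markov_inequality_measure[where A = "{}"]) auto
  ultimately show ?thesis by simp
qed

lemma cell_T_iterate_pred:
  assumes "countable_partition M P"
  shows "Measurable.pred M (\<lambda>x. cell P ((T ^^ k) x) = c)"
proof -
  have part: "partition_on (space M) P" and Pm: "P \<subseteq> sets M"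
    using assms by (auto simp: countable_partition_def)
  have cell_iff: "cell P x = c \<longleftrightarrow> c \<in> P \<and> x \<in> c" if "x \<in> space M" for x
    using cell_eqI[OF part] cell_in_partition[OF part that] by metis
  show ?thesis
  proof (cases "c \<in> P")
    case True
    then have [measurable]: "c \<in> sets M" using Pm by auto
    have "Measurable.pred M (\<lambda>x. (T ^^ k) x \<in> c)" by measurable
    then show ?thesis
      by (rule measurable_cong[THEN iffD2, rotated])
        (use True in \<open>simp add: cell_iff T_iterate_in_space\<close>)
  next
    case False
    have "Measurable.pred M (\<lambda>x. False)" by measurable
    then show ?thesis
      by (rule measurable_cong[THEN iffD2, rotated])
        (use False in \<open>simp add: cell_iff T_iterate_in_space\<close>)
  qed
qed

lemma hamming_ball_measurable:
  assumes P: "countable_partition M P"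
  shows "hamming_ball M T n P z \<epsilon> \<in> sets M"
proof -
  note [measurable] = cell_T_iterate_pred[OF P]
  have "hamming_dist T P n z y
      = (\<Sum>k<n. if cell P ((T ^^ k) y) = cell P ((T ^^ k) z) then 0 else 1) / real n" for y
  proof -
    have "real (card {k. k < n \<and> cell P ((T ^^ k) z) \<noteq> cell P ((T ^^ k) y)})
        = (\<Sum>k\<in>{k \<in> {..<n}. cell P ((T ^^ k) y) \<noteq> cell P ((T ^^ k) z)}. 1)"
      by (simp add: eq_commute)
    also have "\<dots> = (\<Sum>k<n. if cell P ((T ^^ k) y) \<noteq> cell P ((T ^^ k) z) then 1 else 0)"
      by (rule sum.inter_filter) simp
    also have "\<dots> = (\<Sum>k<n. if cell P ((T ^^ k) y) = cell P ((T ^^ k) z) then 0 else 1)"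
      by (rule sum.cong) auto
    finally show ?thesis by (simp add: hamming_dist_def)
  qed
  then show ?thesis unfolding hamming_ball_def by simp measurable
qed

text \<open>A ball depends on its centre only through the \<open>P\<close>-name of length \<open>n\<close>, and there are countably many
  such names.\<close>

lemma countable_hamming_balls:
  assumes P: "countable_partition M P"
  shows "countable ((\<lambda>z. hamming_ball M T n P z \<epsilon>) ` space M)"
proof -
  define name where "name z = (\<lambda>k\<in>{..<n}. cell P ((T ^^ k) z))" for z
  have part: "partition_on (space M) P" and "countable P"
    using P by (auto simp: countable_partition_def)
  have "name ` space M \<subseteq> PiE {..<n} (\<lambda>_. P)"
    using cell_in_partition(1)[OF part T_iterate_in_space] by (auto simp: name_def)
  then have cnt: "countable (name ` space M)"
    by (rule countable_subset) (use \<open>countable P\<close> in \<open>auto intro: countable_PiE\<close>)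
  have "hamming_ball M T n P z \<epsilon>
      = (\<lambda>w. {y \<in> space M. real (card {k. k < n \<and> w k \<noteq> cell P ((T ^^ k) y)}) / real n \<le> \<epsilon>}) (name z)" for z
  proof -
    have "{k. k < n \<and> name z k \<noteq> c k} = {k. k < n \<and> cell P ((T ^^ k) z) \<noteq> c k}" for c
      by (auto simp: name_def)
    then show ?thesis by (simp add: hamming_ball_def hamming_dist_def)
  qed
  then have eq: "(\<lambda>z. hamming_ball M T n P z \<epsilon>) ` space M
     = (\<lambda>w. {y \<in> space M. real (card {k. k < n \<and> w k \<noteq> cell P ((T ^^ k) y)}) / real n \<le> \<epsilon>}) ` name ` space M"
    by (simp add: image_image)
  show ?thesis unfolding eq by (rule countable_image[OF cnt])
qed

definition ball_union :: "'a set set \<Rightarrow> nat \<Rightarrow> real \<Rightarrow> 'a set \<Rightarrow> 'a set" where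
  "ball_union P n \<epsilon> F = (\<Union>z\<in>F. hamming_ball M T n P z \<epsilon>)"

definition finite_ball_unions :: "'a set set \<Rightarrow> nat \<Rightarrow> real \<Rightarrow> 'a set set" where
  "finite_ball_unions P n \<epsilon> = ball_union P n \<epsilon> ` {F. finite F \<and> F \<subseteq> space M}"

lemma countable_finite_ball_unions:
  assumes "countable_partition M P"
  shows "countable (finite_ball_unions P n \<epsilon>)"
proof -
  let ?balls = "(\<lambda>z. hamming_ball M T n P z \<epsilon>) ` space M"
  have "finite_ball_unions P n \<epsilon> \<subseteq> Union ` {\<A>. finite \<A> \<and> \<A> \<subseteq> ?balls}"
    unfolding finite_ball_unions_def ball_union_def
    by (rule image_subsetI, rule image_eqI[OF refl]) auto
  moreover have "countable (Union ` {\<A>. finite \<A> \<and> \<A> \<subseteq> ?balls})"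
    by (intro countable_image countable_Collect_finite_subset countable_hamming_balls[OF assms])
  ultimately show ?thesis by (rule countable_subset)
qed

lemma ball_union_measurable:
  assumes "countable_partition M P" "finite F"
  shows "ball_union P n \<epsilon> F \<in> sets M"
  using assms by (auto simp: ball_union_def intro!: hamming_ball_measurable)

section \<open>Relative complexity as a random variable\<close>

lemma pred_Bex_countable:
  assumes "countable I" "\<And>i. i \<in> I \<Longrightarrow> Measurable.pred M (P i)"
  shows "Measurable.pred M (\<lambda>x. \<exists>i\<in>I. P i x)"
proof -
  have "{x \<in> space M. \<exists>i\<in>I. P i x} = (\<Union>i\<in>I. {x \<in> space M. P i x})" by auto
  also have "\<dots> \<in> sets M"
    using assms by (intro sets.countable_UN') (auto simp: pred_def)
  finally show ?thesis by (simp add: pred_def)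
qed

text \<open>Quantifying over the countably many finite unions of balls in place of their sets of centres makes
  the measurability of the complexity visible. The Bochner integral of a non-measurable function is 0,
  so this measurability is essential for convergence in distribution.\<close>

lemma rel_complexity_alt:
  "rel_complexity M T C P n \<epsilon> x =
    (LEAST j. \<exists>A\<in>ball_union P n \<epsilon> ` {F. finite F \<and> F \<subseteq> space M \<and> card F = j}.
        cond_measure M C A x > 1 - \<epsilon>)"
  unfolding rel_complexity_def ball_union_def by (rule arg_cong[where f = Least]) auto

lemma cond_measure_measurable [measurable]: "cond_measure M C A \<in> borel_measurable M"
  unfolding cond_measure_def by (rule borel_measurable_cond_exp2)

lemma rel_complexity_measurable:
  assumes P: "countable_partition M P"
  shows "rel_complexity M T C P n \<epsilon> \<in> M \<rightarrow>\<^sub>M count_space UNIV"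
proof -
  have "Measurable.pred M (\<lambda>x. \<exists>A\<in>ball_union P n \<epsilon> ` {F. finite F \<and> F \<subseteq> space M \<and> card F = j}.
        cond_measure M C A x > 1 - \<epsilon>)" for j
  proof (rule pred_Bex_countable)
    have "ball_union P n \<epsilon> ` {F. finite F \<and> F \<subseteq> space M \<and> card F = j} \<subseteq> finite_ball_unions P n \<epsilon>"
      by (auto simp: finite_ball_unions_def)
    then show "countable (ball_union P n \<epsilon> ` {F. finite F \<and> F \<subseteq> space M \<and> card F = j})"
      using countable_finite_ball_unions[OF P] by (rule countable_subset)
  qed measurable
  then show ?thesis unfolding rel_complexity_alt[abs_def] by (rule measurable_Least)
qed

sublocale finite_measure_subalgebra M C
  by unfold_locales (rule subalg)

text \<open>The conditional form of \<open>m(A) + m(G) \<le> 1 + m(A \<inter> G)\<close>.\<close>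

lemma cond_measure_inter:
  assumes [measurable]: "A \<in> sets M" "G \<in> sets M" "A' \<in> sets M" and sub: "A \<inter> G \<subseteq> A'"
  shows "AE x in M. cond_measure M C A x + cond_measure M C G x \<le> 1 + cond_measure M C A' x"
proof -
  have int: "integrable M (indicator S :: 'a \<Rightarrow> real)" if "S \<in> sets M" for S
    using that by (simp add: integrable_indicator_iff emeasure_eq_measure)
  have "AE x in M. real_cond_exp M C (\<lambda>x. indicator A x + indicator G x) x
      \<le> real_cond_exp M C (\<lambda>x. 1 + indicator A' x) x"
    using sub int by (intro real_cond_exp_mono Bochner_Integration.integrable_add) (auto split: split_indicator)
  moreover have "AE x in M. real_cond_exp M C (\<lambda>x. indicator A x + indicator G x) x
      = cond_measure M C A x + cond_measure M C G x"
    unfolding cond_measure_def using int by (intro real_cond_exp_add) auto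
  moreover have "AE x in M. real_cond_exp M C (\<lambda>x. 1 + indicator A' x) x
      = real_cond_exp M C (\<lambda>_. 1) x + cond_measure M C A' x"
    unfolding cond_measure_def using int by (intro real_cond_exp_add) auto
  moreover have "AE x in M. real_cond_exp M C (\<lambda>_. 1) x = 1"
    by (intro real_cond_exp_F_meas) auto
  ultimately show ?thesis by eventually_elim simp
qed

text \<open>Markov's inequality for the conditional measure of the complement of \<open>A\<close>.\<close>

lemma measure_cond_measure_small:
  assumes [measurable]: "A \<in> sets M" and "c > 0"
  shows "measure M {x \<in> space M. cond_measure M C A x \<le> 1 - c} \<le> (1 - measure M A) / c"
proof -
  have int: "integrable M (indicator A :: 'a \<Rightarrow> real)"
    by (simp add: integrable_indicator_iff emeasure_eq_measure)
  have int': "integrable M (cond_measure M C A)" and "(\<integral>x. cond_measure M C A x \<partial>M) = measure M A"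
    unfolding cond_measure_def using real_cond_exp_int[OF int] by auto
  then have eq: "(\<integral>x. 1 - cond_measure M C A x \<partial>M) = 1 - measure M A"
    by (simp add: prob_space)
  have "AE x in M. cond_measure M C A x \<le> 1"
    unfolding cond_measure_def using int by (intro real_cond_exp_le_c) auto
  then have "measure M {x \<in> space M. 1 - cond_measure M C A x \<ge> c}
      \<le> (\<integral>x. 1 - cond_measure M C A x \<partial>M) / c"
    using int' \<open>c > 0\<close> by (intro integral_Markov_inequality_measure[where A = "{}"]) auto
  then show ?thesis by (simp add: eq algebra_simps)
qed

lemma hamming_ball_self: "z \<in> space M \<Longrightarrow> \<epsilon> \<ge> 0 \<Longrightarrow> z \<in> hamming_ball M T n P z \<epsilon>"
  by (simp add: hamming_ball_def hamming_dist_def)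

lemma hamming_ball_subset_space: "hamming_ball M T n P z \<epsilon> \<subseteq> space M"
  by (auto simp: hamming_ball_def)

text \<open>Countably many balls cover the space, so finite unions of them have measure arbitrarily close to 1,
  and Markov's inequality passes this to conditional measures. Without admissible families the minimum
  defining the complexity would be a meaningless default value.\<close>

lemma AE_ball_union_admissible:
  assumes P: "countable_partition M P" and "\<epsilon> > 0"
  shows "AE x in M. \<exists>F. finite F \<and> F \<subseteq> space M \<and> cond_measure M C (ball_union P n \<epsilon> F) x > 1 - \<epsilon>"
proof -
  let ?balls = "(\<lambda>z. hamming_ball M T n P z \<epsilon>) ` space M"
  have ne: "?balls \<noteq> {}" using not_empty by auto
  define A where "A = from_nat_into ?balls"
  have "range A = ?balls"
    unfolding A_def by (rule range_from_nat_into[OF ne countable_hamming_balls[OF P]])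
  then have "\<forall>i. \<exists>z. z \<in> space M \<and> A i = hamming_ball M T n P z \<epsilon>"
    by (metis (no_types, lifting) imageE rangeI)
  then obtain z where z: "\<And>i. z i \<in> space M" "\<And>i. A i = hamming_ball M T n P (z i) \<epsilon>" by metis
  have UA: "(\<Union>i. A i) = space M"
    unfolding \<open>range A = ?balls\<close>
    using hamming_ball_self[OF _ less_imp_le[OF \<open>\<epsilon> > 0\<close>]] hamming_ball_subset_space by blast
  have Am [measurable]: "A i \<in> sets M" for i by (simp add: z hamming_ball_measurable[OF P])
  \<comment> \<open>The points at which no finite union is admissible.\<close>
  define S where "S = {x \<in> space M. \<not> (\<exists>U\<in>finite_ball_unions P n \<epsilon>. cond_measure M C U x > 1 - \<epsilon>)}"
  have [measurable]: "Measurable.pred M (\<lambda>x. \<exists>U\<in>finite_ball_unions P n \<epsilon>. cond_measure M C U x > 1 - \<epsilon>)"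
    by (rule pred_Bex_countable[OF countable_finite_ball_unions[OF P]]) measurable
  have [measurable]: "S \<in> sets M" unfolding S_def by measurable
  have "measure M S \<le> 0"
  proof (rule field_le_epsilon)
    fix \<tau> :: real assume "\<tau> > 0"
    then have "\<epsilon> * \<tau> > 0" using \<open>\<epsilon> > 0\<close> by simp
    from measure_UN_minus_finite_UN_small[of A, OF Am this] obtain r
      where r: "measure M ((\<Union>i. A i) - (\<Union>i<r. A i)) < \<epsilon> * \<tau>" by auto
    have Um: "(\<Union>i<r. A i) \<in> sets M" by auto
    have "(\<Union>i<r. A i) = ball_union P n \<epsilon> (z ` {..<r})" by (simp add: z(2) ball_union_def)
    then have "(\<Union>i<r. A i) \<in> finite_ball_unions P n \<epsilon>"
      using z(1) by (auto simp: finite_ball_unions_def)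
    then have "measure M S \<le> measure M {x \<in> space M. cond_measure M C (\<Union>i<r. A i) x \<le> 1 - \<epsilon>}"
      by (intro finite_measure_mono) (auto simp: S_def not_less)
    also have "\<dots> \<le> (1 - measure M (\<Union>i<r. A i)) / \<epsilon>"
      using Um \<open>\<epsilon> > 0\<close> by (rule measure_cond_measure_small)
    also have "\<dots> \<le> (\<epsilon> * \<tau>) / \<epsilon>"
      using r prob_compl[OF Um] \<open>\<epsilon> > 0\<close> unfolding UA by (intro divide_right_mono) auto
    finally show "measure M S \<le> 0 + \<tau>" using \<open>\<epsilon> > 0\<close> by simp
  qed
  then have "S \<in> null_sets M"
    by (intro null_setsI) (auto simp: emeasure_eq_measure measure_le_0_iff)
  then have "AE x in M. x \<notin> S" by (rule AE_not_in)
  with AE_space show ?thesis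
    by eventually_elim (auto simp: S_def finite_ball_unions_def)
qed

section \<open>Comparison of complexities\<close>

lemma rel_complexity_attained:
  assumes "\<exists>F. finite F \<and> F \<subseteq> space M \<and> cond_measure M C (ball_union P n \<epsilon> F) x > 1 - \<epsilon>"
  obtains F where "finite F" "F \<subseteq> space M" "card F = rel_complexity M T C P n \<epsilon> x"
    "cond_measure M C (ball_union P n \<epsilon> F) x > 1 - \<epsilon>"
proof -
  have "\<exists>j F. finite F \<and> F \<subseteq> space M \<and> card F = j \<and>
        cond_measure M C (\<Union>z\<in>F. hamming_ball M T n P z \<epsilon>) x > 1 - \<epsilon>"
    using assms by (auto simp: ball_union_def)
  from LeastI_ex[OF this] that show thesis
    unfolding rel_complexity_def[symmetric] ball_union_def by blast
qed

lemma rel_complexity_le_card: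
  assumes "finite F" "F \<subseteq> space M" "cond_measure M C (ball_union P n \<epsilon> F) x > 1 - \<epsilon>"
  shows "rel_complexity M T C P n \<epsilon> x \<le> card F"
  unfolding rel_complexity_def
  by (rule Least_le) (use assms in \<open>auto simp: ball_union_def\<close>)

text \<open>The centres of \<open>P\<close>-balls need not lie in \<open>G\<close>, where the two distances are comparable. Each ball that
  meets \<open>G\<close> is given a new centre in \<open>G\<close>, which doubles the radius; the other balls are dropped.\<close>

lemma recentred_ball_union:
  assumes F: "finite F" "F \<subseteq> space M" and G: "G \<subseteq> space M"
    and recode: "\<And>y y'. y \<in> G \<Longrightarrow> y' \<in> G \<Longrightarrow> hamming_dist T P n y' y \<le> 2 * \<delta> \<Longrightarrow> hamming_dist T Q n y' y \<le> \<epsilon>"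
  obtains F' where "finite F'" "F' \<subseteq> space M" "card F' \<le> card F"
    "ball_union P n \<delta> F \<inter> G \<subseteq> ball_union Q n \<epsilon> F'"
proof -
  define c where "c z = (SOME y. y \<in> hamming_ball M T n P z \<delta> \<inter> G)" for z
  define F1 where "F1 = {z \<in> F. hamming_ball M T n P z \<delta> \<inter> G \<noteq> {}}"
  have c: "c z \<in> hamming_ball M T n P z \<delta> \<inter> G" if "z \<in> F1" for z
    unfolding c_def by (rule someI_ex) (use that in \<open>auto simp: F1_def\<close>)
  have "F1 \<subseteq> F" by (auto simp: F1_def)
  then have "card (c ` F1) \<le> card F"
    using F(1) by (meson card_image_le card_mono finite_subset le_trans)
  moreover have "finite (c ` F1)" using F by (simp add: F1_def)
  moreover have "c ` F1 \<subseteq> space M" using c G by blast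
  moreover have "ball_union P n \<delta> F \<inter> G \<subseteq> ball_union Q n \<epsilon> (c ` F1)"
  proof
    fix y assume "y \<in> ball_union P n \<delta> F \<inter> G"
    then obtain z where z: "z \<in> F" "y \<in> hamming_ball M T n P z \<delta>" and y: "y \<in> G"
      by (auto simp: ball_union_def)
    then have "z \<in> F1" by (auto simp: F1_def)
    have "hamming_dist T P n (c z) y \<le> hamming_dist T P n (c z) z + hamming_dist T P n z y"
      by (rule hamming_dist_triangle)
    also have "\<dots> \<le> 2 * \<delta>"
      using z(2) c[OF \<open>z \<in> F1\<close>] hamming_dist_commute[of P n "c z" z]
      by (simp add: hamming_ball_def)
    finally have "hamming_dist T Q n (c z) y \<le> \<epsilon>"
      using c[OF \<open>z \<in> F1\<close>] y by (intro recode) auto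
    then show "y \<in> ball_union Q n \<epsilon> (c ` F1)"
      using \<open>z \<in> F1\<close> y G by (auto simp: ball_union_def hamming_ball_def)
  qed
  ultimately show thesis using that by blast
qed

text \<open>Off a null set the inequality of conditional measures holds simultaneously for all of the countably
  many pairs of finite unions of balls. At a point where the conditional measure of \<open>G\<close> exceeds
  \<open>1 - \<beta>\<close>, it makes the recentred family of an optimal \<open>P\<close>-family admissible for \<open>Q\<close>.\<close>

lemma measure_rel_complexity_less:
  assumes P: "countable_partition M P" and Q: "countable_partition M Q"
    and [measurable]: "G \<in> sets M" and "\<delta> > 0" "\<beta> > 0" "\<delta> + \<beta> \<le> \<epsilon>"
    and recode: "\<And>y y'. y \<in> G \<Longrightarrow> y' \<in> G \<Longrightarrow> hamming_dist T P n y' y \<le> 2 * \<delta> \<Longrightarrow> hamming_dist T Q n y' y \<le> \<epsilon>"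
  shows "measure M {x \<in> space M. rel_complexity M T C P n \<delta> x < rel_complexity M T C Q n \<epsilon> x}
    \<le> (1 - measure M G) / \<beta>"
proof -
  have "AE x in M. \<forall>A\<in>finite_ball_unions P n \<delta>. \<forall>A'\<in>finite_ball_unions Q n \<epsilon>.
      A \<inter> G \<subseteq> A' \<longrightarrow> cond_measure M C A x + cond_measure M C G x \<le> 1 + cond_measure M C A' x"
    using cond_measure_inter ball_union_measurable[OF P] ball_union_measurable[OF Q]
    by (intro AE_ball_countable' AE_impI countable_finite_ball_unions P Q)
      (auto simp: finite_ball_unions_def)
  moreover have "AE x in M. \<exists>F. finite F \<and> F \<subseteq> space M \<and> cond_measure M C (ball_union P n \<delta> F) x > 1 - \<delta>"
    using P \<open>\<delta> > 0\<close> by (rule AE_ball_union_admissible)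
  ultimately have "AE x in M. rel_complexity M T C P n \<delta> x < rel_complexity M T C Q n \<epsilon> x
      \<longrightarrow> cond_measure M C G x \<le> 1 - \<beta>"
  proof eventually_elim
    case (elim x)
    from rel_complexity_attained[OF elim(2)] obtain F where
      F: "finite F" "F \<subseteq> space M" "card F = rel_complexity M T C P n \<delta> x"
        "cond_measure M C (ball_union P n \<delta> F) x > 1 - \<delta>" .
    obtain F' where F': "finite F'" "F' \<subseteq> space M" "card F' \<le> card F"
        "ball_union P n \<delta> F \<inter> G \<subseteq> ball_union Q n \<epsilon> F'"
      by (rule recentred_ball_union[OF F(1,2) sets.sets_into_space[OF \<open>G \<in> sets M\<close>], where P = P and Q = Q and n = n and \<delta> = \<delta> and \<epsilon> = \<epsilon>])
        (use recode in blast)+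
    have le: "cond_measure M C (ball_union P n \<delta> F) x + cond_measure M C G x
        \<le> 1 + cond_measure M C (ball_union Q n \<epsilon> F') x"
      using elim(1) F F' by (auto simp: finite_ball_unions_def)
    show ?case
    proof (intro impI, rule ccontr)
      assume less: "rel_complexity M T C P n \<delta> x < rel_complexity M T C Q n \<epsilon> x"
        and "\<not> cond_measure M C G x \<le> 1 - \<beta>"
      then have "cond_measure M C (ball_union Q n \<epsilon> F') x > 1 - \<epsilon>"
        using le F(4) \<open>\<delta> + \<beta> \<le> \<epsilon>\<close> by linarith
      from rel_complexity_le_card[OF F'(1,2) this] less F(3) F'(3) show False by linarith
    qed
  qed
  then have "measure M {x \<in> space M. rel_complexity M T C P n \<delta> x < rel_complexity M T C Q n \<epsilon> x}
      \<le> measure M {x \<in> space M. cond_measure M C G x \<le> 1 - \<beta>}"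
    by (intro finite_measure_mono_AE) auto
  also have "\<dots> \<le> (1 - measure M G) / \<beta>"
    by (rule measure_cond_measure_small) (use \<open>\<beta> > 0\<close> in auto)
  finally show ?thesis .
qed

text \<open>Markov's inequality is applied twice, each time at the cost of a factor \<open>1 / \<beta>\<close>: to the visit
  frequency and to the conditional measure. The coding set \<open>B\<close> is therefore chosen of measure below
  \<open>\<beta>\<^sup>3\<close>, which leaves an exceptional set of measure at most \<open>\<beta>\<close>.\<close>

lemma rel_complexity_generator_dominates:
  assumes P: "generator M T P" and Q: "countable_partition M Q" and "\<epsilon> > 0" "\<rho> > 0"
  shows "\<forall>\<^sub>F \<delta> in at_right 0. \<forall>\<^sub>F n in sequentially.
    measure M {x \<in> space M. rel_complexity M T C P n \<delta> x < rel_complexity M T C Q n \<epsilon> x} \<le> \<rho>"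
proof -
  have cP: "countable_partition M P" using P by (simp add: generator_def)
  define \<beta> where "\<beta> = min \<rho> (\<epsilon> / 8)"
  have \<beta>: "\<beta> > 0" "\<beta> \<le> \<rho>" "\<beta> \<le> \<epsilon> / 8" using \<open>\<epsilon> > 0\<close> \<open>\<rho> > 0\<close> by (auto simp: \<beta>_def)
  have "\<beta> ^ 3 > 0" using \<beta>(1) by simp
  then obtain B N where B: "B \<in> sets M" "measure M B < \<beta> ^ 3"
    and code: "\<forall>x\<in>space M - B. \<forall>y\<in>space M - B. same_names P N x y \<longrightarrow> cell Q x = cell Q y"
    using generator_coding[OF P Q] by blast
  \<comment> \<open>In \<open>hamming_dist_recode\<close> the \<open>P\<close>-distance \<open>2 \<delta>\<close>, the boundary effect and the two visit
    frequencies contribute at most \<open>\<epsilon> / 4\<close> each, the two frequencies together.\<close>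
  define \<delta>\<^sub>0 where "\<delta>\<^sub>0 = \<epsilon> / (8 * (2 * real N + 1))"
  have "\<delta>\<^sub>0 > 0" using \<open>\<epsilon> > 0\<close> by (simp add: \<delta>\<^sub>0_def)
  have "\<forall>\<^sub>F \<delta> in at_right 0. \<delta> \<in> {0<..<\<delta>\<^sub>0}"
    using \<open>\<delta>\<^sub>0 > 0\<close> by (rule eventually_at_right_real)
  then show ?thesis
  proof eventually_elim
    case (elim \<delta>)
    then have \<delta>: "\<delta> > 0" "(2 * real N + 1) * \<delta> \<le> \<epsilon> / 8"
      by (auto simp: \<delta>\<^sub>0_def field_simps)
    have "\<delta> \<le> (2 * real N + 1) * \<delta>" using \<delta>(1) by simp
    then have "\<delta> + \<beta> \<le> \<epsilon>" using \<delta>(2) \<beta>(3) \<open>\<epsilon> > 0\<close> by linarith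
    have "(\<lambda>n. 2 * real N / real n) \<longlonglongrightarrow> 0"
      by (rule real_tendsto_divide_at_top[OF tendsto_const filterlim_real_sequentially])
    then have "\<forall>\<^sub>F n in sequentially. 2 * real N / real n < \<epsilon> / 4"
      using \<open>\<epsilon> > 0\<close> by (intro order_tendstoD) auto
    with eventually_gt_at_top[of 0] show ?case
    proof eventually_elim
      case (elim n)
      define G where "G = {x \<in> space M. visit_freq B n x < \<beta>}"
      have [measurable]: "G \<in> sets M" unfolding G_def using B(1) by measurable
      have "space M - G = {x \<in> space M. visit_freq B n x \<ge> \<beta>}" by (auto simp: G_def)
      then have "1 - measure M G \<le> measure M B / \<beta>"
        using measure_visit_freq_large[OF B(1) \<beta>(1) elim(1)] prob_compl[of G] by simp
      also have "\<dots> \<le> \<beta> ^ 3 / \<beta>" using B(2) \<beta>(1) by (intro divide_right_mono) auto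
      finally have "(1 - measure M G) / \<beta> \<le> (\<beta> ^ 3 / \<beta>) / \<beta>"
        using \<beta>(1) by (intro divide_right_mono) auto
      also have "\<dots> = \<beta>" using \<beta>(1) by (simp add: power3_eq_cube)
      also note \<beta>(2)
      finally have "(1 - measure M G) / \<beta> \<le> \<rho>" .
      moreover have "hamming_dist T Q n y' y \<le> \<epsilon>"
        if "y \<in> G" "y' \<in> G" "hamming_dist T P n y' y \<le> 2 * \<delta>" for y y'
      proof -
        have "hamming_dist T Q n y' y \<le> (2 * real N + 1) * hamming_dist T P n y' y
            + 2 * real N / real n + visit_freq B n y' + visit_freq B n y"
          using that elim(1) code by (intro hamming_dist_recode) (auto simp: G_def)
        moreover have "(2 * real N + 1) * hamming_dist T P n y' y \<le> (2 * real N + 1) * (2 * \<delta>)"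
          using that(3) by (intro mult_left_mono) auto
        moreover have "(2 * real N + 1) * (2 * \<delta>) = 2 * ((2 * real N + 1) * \<delta>)" by simp
        moreover have "visit_freq B n y < \<beta>" "visit_freq B n y' < \<beta>" using that by (auto simp: G_def)
        ultimately show ?thesis using elim(2) \<delta>(2) \<beta>(3) \<open>\<epsilon> > 0\<close> by linarith
      qed
      ultimately show ?case
        using measure_rel_complexity_less[OF cP Q _ \<delta>(1) \<beta>(1) \<open>\<delta> + \<beta> \<le> \<epsilon>\<close>, of G n] by fastforce
    qed
  qed
qed

lemma log_complexity_ratio_measurable:
  assumes "countable_partition M P"
  shows "log_complexity_ratio M T C P n d k \<epsilon> \<in> borel_measurable M"
proof -
  note [measurable] = rel_complexity_measurable[OF assms]
  show ?thesis unfolding log_complexity_ratio_def[abs_def] by measurable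
qed

text \<open>True from 0 on, since \<open>ln 0 = 0\<close>; the complexity can vanish when \<open>\<epsilon> > 1\<close>.\<close>

lemma ln_of_nat_mono: "a \<le> b \<Longrightarrow> ln (real a) \<le> ln (real b)"
  by (cases "a = 0") (cases "b = 0", auto)

lemma log_complexity_ratio_dominated:
  assumes P: "generator M T P" and Q: "countable_partition M Q"
    and n: "filterlim n at_top sequentially" and d: "\<And>k. k \<ge> 1 \<Longrightarrow> d k > 0"
  shows "asymptotically_dominated M (log_complexity_ratio M T C Q n d) (log_complexity_ratio M T C P n d)"
  unfolding asymptotically_dominated_def
proof (intro allI impI)
  fix \<epsilon> \<rho> :: real assume "\<epsilon> > 0" "\<rho> > 0"
  have cP: "countable_partition M P" using P by (simp add: generator_def)
  from rel_complexity_generator_dominates[OF P Q \<open>\<epsilon> > 0\<close> \<open>\<rho> > 0\<close>]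
  show "\<forall>\<^sub>F \<delta> in at_right 0. \<forall>\<^sub>F k in sequentially. measure M {x \<in> space M.
      log_complexity_ratio M T C P n d k \<delta> x < log_complexity_ratio M T C Q n d k \<epsilon> x} \<le> \<rho>"
  proof eventually_elim
    case (elim \<delta>)
    from eventually_compose_filterlim[OF this n] eventually_ge_at_top[of 1]
    show ?case
    proof eventually_elim
      case (elim k)
      let ?S = "{x \<in> space M. rel_complexity M T C P (n k) \<delta> x < rel_complexity M T C Q (n k) \<epsilon> x}"
      note [measurable] = rel_complexity_measurable[OF cP] rel_complexity_measurable[OF Q]
      have "rel_complexity M T C P (n k) \<delta> x < rel_complexity M T C Q (n k) \<epsilon> x"
        if less: "log_complexity_ratio M T C P n d k \<delta> x < log_complexity_ratio M T C Q n d k \<epsilon> x" for x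
      proof (rule ccontr)
        assume "\<not> ?thesis"
        then have "log_complexity_ratio M T C Q n d k \<epsilon> x \<le> log_complexity_ratio M T C P n d k \<delta> x"
          unfolding log_complexity_ratio_def
          using d[OF elim(2)] by (intro divide_right_mono ln_of_nat_mono) auto
        with less show False by linarith
      qed
      moreover have "?S \<in> sets M"
      proof -
        have "{x \<in> space M. real (rel_complexity M T C P (n k) \<delta> x)
            < real (rel_complexity M T C Q (n k) \<epsilon> x)} \<in> sets M" by measurable
        then show ?thesis by simp
      qed
      ultimately have "measure M {x \<in> space M.
          log_complexity_ratio M T C P n d k \<delta> x < log_complexity_ratio M T C Q n d k \<epsilon> x} \<le> measure M ?S"
        by (intro finite_measure_mono) auto
      with elim(1) show ?case by linarith
    qed
  qed
qed

end

section \<open>Independence of the generator\<close>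

theorem theorem2:
  fixes M C :: "'a measure" and T :: "'a \<Rightarrow> 'a"
    and n :: "nat \<Rightarrow> nat" and d :: "nat \<Rightarrow> real" and t :: real
  assumes "prob_space M"
    and "invertible_mpt M T"
    and "is_factor M T C"
    and "\<And>k. k \<ge> 1 \<Longrightarrow> n k > 0"
    and "filterlim n at_top sequentially"
    and "\<And>k. k \<ge> 1 \<Longrightarrow> d k > 0"
    and "t \<ge> 0"
  shows
    "(\<forall>(N :: 'b measure) Y. prob_space N \<and> Y \<in> borel_measurable N \<longrightarrow>
        (\<exists>P. generator M T P \<and> tends_in_distr M (log_complexity_ratio M T C P n d) N Y) \<longrightarrow>
        (\<forall>Q. generator M T Q \<longrightarrow> tends_in_distr M (log_complexity_ratio M T C Q n d) N Y))
     \<and> ((\<exists>P. generator M T P \<and>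
           tends_zero_in_measure M (log_complexity_ratio M T C P n (\<lambda>k. real (n k) powr t))) \<longrightarrow>
        upper_E_dim M T C n \<le> ennreal t)
     \<and> ((\<exists>P. countable_partition M P \<and>
           tends_infinity_in_measure M (log_complexity_ratio M T C P n (\<lambda>k. real (n k) powr t))) \<longrightarrow>
        lower_E_dim M T C n \<ge> ennreal t)"
proof -
  interpret mpt_subalgebra M T C
    using assms(1-3) by (simp add: mpt_subalgebra_def mpt_subalgebra_axioms_def is_factor_def)
  have partition: "countable_partition M P" if "generator M T P" for P
    using that by (simp add: generator_def)
  show ?thesis
  proof (intro conjI allI impI)
    fix N :: "'b measure" and Y Q
    assume NY: "prob_space N \<and> Y \<in> borel_measurable N"
      and ex: "\<exists>P. generator M T P \<and> tends_in_distr M (log_complexity_ratio M T C P n d) N Y"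
      and Q: "generator M T Q"
    from ex obtain P where P: "generator M T P"
        and lim: "tends_in_distr M (log_complexity_ratio M T C P n d) N Y" by blast
    show "tends_in_distr M (log_complexity_ratio M T C Q n d) N Y"
      using NY P Q partition assms(5,6)
      by (intro tends_in_distr_dominated[OF prob_space_axioms _ _ _ _ _ _ lim]
            log_complexity_ratio_measurable log_complexity_ratio_dominated) auto
  next
    assume "\<exists>P. generator M T P \<and>
      tends_zero_in_measure M (log_complexity_ratio M T C P n (\<lambda>k. real (n k) powr t))"
    then obtain P where P: "generator M T P"
      and zero: "tends_zero_in_measure M (log_complexity_ratio M T C P n (\<lambda>k. real (n k) powr t))" by blast
    have "tends_zero_in_measure M (log_complexity_ratio M T C Q n (\<lambda>k. real (n k) powr t))"
      if "countable_partition M Q" for Q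
      using P that partition assms(4,5)
      by (intro tends_zero_in_measure_dominated[OF prob_space_axioms _ _ _ zero]
            log_complexity_ratio_measurable log_complexity_ratio_dominated) fastforce+
    then show "upper_E_dim M T C n \<le> ennreal t"
      unfolding upper_E_dim_def using assms(7) by (intro Inf_lower) blast
  next
    assume "\<exists>P. countable_partition M P \<and>
      tends_infinity_in_measure M (log_complexity_ratio M T C P n (\<lambda>k. real (n k) powr t))"
    then show "ennreal t \<le> lower_E_dim M T C n"
      unfolding lower_E_dim_def using assms(7) by (intro Sup_upper) blast
  qed
qed

end
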